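(* Let $\mathfrak k=\sum_{\underline d}[\mathcal O_{\mathfrak Q_{\underline d}}]\in\prod_{\underline d}M_{\underline d}$. Then: (a) For any $1\le i\le n-1$, $\ e_{i,0}L_i^{-1}L_{i+1}(\mathfrak k)=\frac{v}{1-v^2}\,\mathfrak k$. (b) For any $1\le i\le n-1$, $\ e_{i,1}L_{i-1}^2L_i^{-3}L_{i+1}(\mathfrak k)=\frac{v^{5-i}}{1-v^2}\,\mathfrak k$.
   Context: **Laumon spaces.** $\mathbf C$ is a smooth projective genus $0$ curve with coordinate $z$, $v\in\mathbb C^\times$ acts by $v(z)=v^{-2}z$; $W$ has basis $w_1,\dots,w_n$; $\widetilde T=\{(t_1,\dots,t_n):t_1\cdots t_n=1\}$ acts on $W$ by $w_k\mapsto t_k^2w_k$. For $\underline d=(d_1,\dots,d_{n-1})\in\mathbb N^{n-1}$ ($d_0=d_n=0$), $\mathfrak Q_{\underline d}$ is the moduli space of flags of locally free subsheaves $0\subset\mathcal W_1\subset\dots\subset\mathcal W_{n-1}\subset W\otimes\mathcal O_{\mathbf C}$ with $\mathrm{rk}\,\mathcal W_k=k$, $\deg\mathcal W_k=-d_k$, each $\mathcal W_k$ a subbundle near $\infty$ with fiber $\langle w_1,\dots,w_k\rangle$ at $\infty$; it is smooth quasi-projective with an action of $\widetilde T\times\mathbb C^\times$, with finitely many fixed points $\tilde{\underline d}=(d_{ij})_{1\le j\le i\le n-1}$, $d_i=\sum_jd_{ij}$, $d_{kj}\ge d_{ij}\ge0$ for $i\ge k\ge j$. Put $s_{ij}=t_j^2v^{-2d_{ij}}$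 (also $s_{nj}=t_j^2$). $\mathsf k=\mathrm{Frac}(K^{\widetilde T\times\mathbb C^\times}(\mathrm{pt}))\otimes_{\mathbb C(v)}\mathbb C(v^{1/N})$ ($N$ a positive integer with $(P,P)\subset\frac1N\mathbb Z$ for the $\mathfrak{sl}_n$ weight lattice $P$), $M_{\underline d}=K^{\widetilde T\times\mathbb C^\times}(\mathfrak Q_{\underline d})\otimes\mathsf k$, $M=\bigoplus M_{\underline d}$, with basis the classes $[\tilde{\underline d}]$ of structure sheaves of fixed points. **Operators.** $\mathfrak E_{\underline d,i}\subset\mathfrak Q_{\underline d}\times\mathfrak Q_{\underline d+i}$ ($\underline d+i$: increase $d_i$ by $1$) is the correspondence $\{(\mathcal W_\bullet,\mathcal W_\bullet'):\mathcal W_i'\subset\mathcal W_i,\mathcal W_j=\mathcal W_j'\,(j\ne i)\}$ with projections $\mathbf p,\mathbf q$ to $\mathfrak Q_{\underline d},\mathfrak Q_{\underline d+i}$ and line bundle $\mathcal L_i$ with fiber $\Gamma(\mathbf C,\mathcal W_i/\mathcal W_i')$. Set, for $r\in\mathbb Z$, $$e_{i,r}=t_{i+1}^{-1}v^{d_{i+1}-d_i+1-i}\,\mathbf p_*\bigl((v^i\mathcal L_i)^{\otimes r}\otimes\mathbf q^*\bigr):M_{\underline d}\to M_{\underline d-i},$$ and $L_i=t_1\cdots t_iv^{-d_i+\frac{i(i-1)}2}$ on $M_{\underline d}$ for $0\le i\le n$ (so $L_0=1$ and $L_n=v^{n(n-1)/2}$). In the fixed point basis (coefficient of $[\tilde{\underline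 d}-\delta_{ij}]$ in the image of $[\tilde{\underline d}]$, $j\le i$; other coefficients vanish) $$(e_{i,0})_{[\tilde{\underline d},\tilde{\underline d}-\delta_{ij}]}=(1-v^2)^{-1}t_{i+1}^{-1}v^{d_{i+1}-d_i+1-i}\prod_{j\ne k\le i}(1-s_{ik}/s_{ij})^{-1}\prod_{k\le i+1}(1-s_{i+1,k}/s_{ij}),\qquad(e_{i,1})_{[\tilde{\underline d},\tilde{\underline d}-\delta_{ij}]}=v^{i+2}s_{ij}\,(e_{i,0})_{[\tilde{\underline d},\tilde{\underline d}-\delta_{ij}]}.$$ By localization $[\mathcal O_{\mathfrak Q_{\underline d}}]=\sum_{\tilde{\underline d}}a_{\tilde{\underline d}}[\tilde{\underline d}]$ with $a_{\tilde{\underline d}}=\prod_{w\in T_{\tilde{\underline d}}\mathfrak Q_{\underline d}}(1-w)^{-1}$, which satisfies $a_{\tilde{\underline d}+\delta_{ij}}(\mathbf p_*\mathbf q^* )_{[\tilde{\underline d}+\delta_{ij},\tilde{\underline d}]}=a_{\tilde{\underline d}}(\mathbf q_*\mathbf p^* )_{[\tilde{\underline d},\tilde{\underline d}+\delta_{ij}]}$ with $(\mathbf q_*\mathbf p^* )_{[\tilde{\underline d},\tilde{\underline d}+\delta_{ij}]}=\frac1{1-v^2}\prod_{j\ne k\le i}(1-s_{ij}/s_{ik})^{-1}\prod_{k\le i-1}(1-s_{ij}/s_{i-1,k})$. *)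

theory Defs
  imports
    Complex_Main
    "HOL-Library.Poly_Mapping"
    "HOL-Library.Function_Algebras"
    "HOL-Computational_Algebra.Fraction_Field"
begin

subsection \<open>The ground field\<close>

text \<open>
  The weight lattice of sl(n): vectors in the sum-zero hyperplane, indexed by 1..n, that pair
  integrally with all coroots; the form is the restriction of the standard dot product.
\<close>

definition weight_lattice :: "nat \<Rightarrow> (nat \<Rightarrow> rat) set" where
  "weight_lattice n = {x. (\<forall>i. i \<notin> {1..n} \<longrightarrow> x i = 0) \<and> (\<Sum>i=1..n. x i) = 0 \<and>
     (\<forall>i\<in>{1..n}. \<forall>j\<in>{1..n}. x i - x j \<in> \<int>)}"

definition weight_form :: "nat \<Rightarrow> (nat \<Rightarrow> rat) \<Rightarrow> (nat \<Rightarrow> rat) \<Rightarrow> rat" where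
  "weight_form n x y = (\<Sum>i=1..n. x i * y i)"

definition admissible_root :: "nat \<Rightarrow> nat \<Rightarrow> bool" where
  "admissible_root n N \<longleftrightarrow> N > 0 \<and>
     (\<forall>x\<in>weight_lattice n. \<forall>y\<in>weight_lattice n. \<exists>m::int. weight_form n x y = of_int m / of_nat N)"

text \<open>
  The equivariant K-theory of a point is the ring of Laurent polynomials in
  \<open>t\<^sub>1, \<dots>, t\<^sub>n\<^sub>-\<^sub>1, v\<close> over the complex numbers.  After adjoining \<open>v\<^bsup>1/N\<^esup>\<close> and passing to fractions one
  has the field of rational functions in the \<open>n\<close> variables \<open>v\<^bsup>1/N\<^esup>, t\<^sub>1, \<dots>, t\<^sub>n\<^sub>-\<^sub>1\<close>; these are the
  variables of index 0 and of index 1, ..., n-1 below.  The type has variables of all indices;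
  \<open>ground_field n\<close> is the subfield generated by the first \<open>n\<close> of them.
\<close>

type_synonym laurent = "(nat \<Rightarrow>\<^sub>0 int) \<Rightarrow>\<^sub>0 complex"
type_synonym scalar = "laurent fract"

definition indet :: "nat \<Rightarrow> scalar" where
  "indet i = Fract (Poly_Mapping.single (Poly_Mapping.single i 1) 1) 1"

definition ground_field :: "nat \<Rightarrow> scalar set" where
  "ground_field n = {Fract p q | p q. q \<noteq> 0 \<and>
     (\<forall>e \<in> Poly_Mapping.keys p \<union> Poly_Mapping.keys q. Poly_Mapping.keys e \<subseteq> {..<n})}"

definition vv :: "nat \<Rightarrow> scalar" where
  "vv N = indet 0 ^ N"

text \<open>\<open>tt n j\<close> is meant for \<open>1 \<le> j \<le> n\<close>; the value at \<open>j = n\<close> encodes \<open>t\<^sub>1 \<cdots> t\<^sub>n = 1\<close>.\<close>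

definition tt :: "nat \<Rightarrow> nat \<Rightarrow> scalar" where
  "tt n j = (if j < n then indet j else inverse (\<Prod>i=1..<n. indet i))"


subsection \<open>Fixed points and the K-group in the fixed point basis\<close>

text \<open>
  A fixed point \<open>(d\<^sub>i\<^sub>j)\<close>, extended by zero outside \<open>1 \<le> j \<le> i \<le> n-1\<close>.  It is the flag
  whose \<open>k\<close>-th term is the direct sum of the \<open>w\<^sub>j \<otimes> O(-d\<^sub>k\<^sub>j \<cdot> 0)\<close>, \<open>1 \<le> j \<le> k\<close>; on the complement
  of infinity this is the \<open>\<complex>[z]\<close>-module freely generated by the \<open>z\<^bsup>d\<^sub>k\<^sub>j\<^esup> w\<^sub>j\<close>.
\<close>

type_synonym fixed_point = "nat \<Rightarrow> nat \<Rightarrow> nat"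

definition fixed_points :: "nat \<Rightarrow> fixed_point set" where
  "fixed_points n = {d.
     (\<forall>i j. \<not> (1 \<le> j \<and> j \<le> i \<and> i \<le> n - 1) \<longrightarrow> d i j = 0) \<and>
     (\<forall>i k j. 1 \<le> j \<and> j \<le> k \<and> k \<le> i \<and> i \<le> n - 1 \<longrightarrow> d i j \<le> d k j)}"

definition deg :: "fixed_point \<Rightarrow> nat \<Rightarrow> nat" where
  "deg d i = (\<Sum>j=1..i. d i j)"

text \<open>
  By localization \<open>M\<^sub>d\<close> has as basis the classes of the finitely many fixed points of degree \<open>d\<close>.
  The K-groups are modelled in this basis: an element of the product of all
  \<open>M\<^sub>d\<close> is the same as an arbitrary function assigning a coordinate to every fixed point.
\<close>

type_synonym kvec = "fixed_point \<Rightarrow> scalar"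

definition M_hat :: "nat \<Rightarrow> kvec set" where
  "M_hat n = {x. (\<forall>d\<in>fixed_points n. x d \<in> ground_field n) \<and> (\<forall>d. d \<notin> fixed_points n \<longrightarrow> x d = 0)}"

definition scale :: "scalar \<Rightarrow> kvec \<Rightarrow> kvec" where
  "scale c x = (\<lambda>d. c * x d)"


subsection \<open>Tangent spaces at fixed points\<close>

text \<open>
  A tangent vector at a flag \<open>W\<^sub>1 \<subset> \<dots> \<subset> W\<^sub>n\<^sub>-\<^sub>1\<close> is a family of homomorphisms
  \<open>\<phi>\<^sub>k : W\<^sub>k \<rightarrow> (W \<otimes> O)/W\<^sub>k\<close>, vanishing at infinity, such that the restriction of \<open>\<phi>\<^sub>k\<^sub>+\<^sub>1\<close> to \<open>W\<^sub>k\<close>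
  equals \<open>\<phi>\<^sub>k\<close> modulo \<open>W\<^sub>k\<^sub>+\<^sub>1\<close>.  At a fixed point we write \<open>\<phi>\<^sub>k\<close> as the sum over \<open>j \<le> k\<close>, \<open>l \<le> n\<close> and
  integers \<open>m\<close> of \<open>\<phi> k j l m\<close> times the map \<open>w\<^sub>j \<mapsto> z\<^sup>m w\<^sub>l\<close>.  A basis of the homomorphisms from the
  \<open>j\<close>-th summand of \<open>W\<^sub>k\<close> to the \<open>l\<close>-th summand of the quotient consists of the monomials with
  \<open>-d\<^sub>k\<^sub>j \<le> m < d\<^sub>k\<^sub>l - d\<^sub>k\<^sub>j\<close> if \<open>l \<le> k\<close> (torsion target) and \<open>-d\<^sub>k\<^sub>j \<le> m < 0\<close> if \<open>l > k\<close>
  (target \<open>O\<close>; the upper bound is the vanishing at infinity).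
\<close>

definition hom_monomial :: "nat \<Rightarrow> fixed_point \<Rightarrow> nat \<Rightarrow> nat \<Rightarrow> nat \<Rightarrow> int \<Rightarrow> bool" where
  "hom_monomial n d k j l m \<longleftrightarrow>
     1 \<le> k \<and> k \<le> n - 1 \<and> 1 \<le> j \<and> j \<le> k \<and> 1 \<le> l \<and> l \<le> n \<and>
     - int (d k j) \<le> m \<and> (if l \<le> k then m < int (d k l) - int (d k j) else m < 0)"

text \<open>
  In the compatibility condition both sides are applied to the generator \<open>z\<^bsup>d\<^sub>k\<^sub>j\<^esup> w\<^sub>j\<close> of \<open>W\<^sub>k\<close>; their
  coefficients at \<open>z\<^bsup>d\<^sub>k\<^sub>j+m\<^esup> w\<^sub>l\<close> are compared whenever this monomial is not in \<open>W\<^sub>k\<^sub>+\<^sub>1\<close>.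
\<close>

definition tangent_space :: "nat \<Rightarrow> fixed_point \<Rightarrow> (nat \<Rightarrow> nat \<Rightarrow> nat \<Rightarrow> int \<Rightarrow> complex) set" where
  "tangent_space n d = {\<phi>.
     (\<forall>k j l m. \<not> hom_monomial n d k j l m \<longrightarrow> \<phi> k j l m = 0) \<and>
     (\<forall>k j l m. 1 \<le> j \<and> j \<le> k \<and> k + 1 \<le> n - 1 \<and> 1 \<le> l \<and> l \<le> n \<and>
        (l \<le> k + 1 \<longrightarrow> int (d k j) + m < int (d (k + 1) l)) \<longrightarrow>
        \<phi> k j l m = \<phi> (k + 1) j l m)}"

text \<open>
  The torus scales \<open>w\<^sub>j \<mapsto> z\<^sup>m w\<^sub>l\<close> by \<open>t\<^sub>l\<^sup>2 t\<^sub>j\<^bsup>-2\<^esup> v\<^bsup>-2m\<^esup>\<close>, and the tangent space is the direct sum over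
  \<open>(j, l, m)\<close> of the following weight subspaces.  (For \<open>j = l\<close> several of them have the same
  weight; this is harmless in the product defining \<open>fp_coeff\<close>.)
\<close>

definition tangent_part ::
    "nat \<Rightarrow> fixed_point \<Rightarrow> nat \<Rightarrow> nat \<Rightarrow> int \<Rightarrow> (nat \<Rightarrow> nat \<Rightarrow> nat \<Rightarrow> int \<Rightarrow> complex) set" where
  "tangent_part n d j l m =
     {\<phi> \<in> tangent_space n d. \<forall>k j' l' m'. (j', l', m') \<noteq> (j, l, m) \<longrightarrow> \<phi> k j' l' m' = 0}"

definition tangent_mult :: "nat \<Rightarrow> fixed_point \<Rightarrow> nat \<Rightarrow> nat \<Rightarrow> int \<Rightarrow> nat" where
  "tangent_mult n d j l m =
     vector_space.dim (\<lambda>(c::complex) \<phi> k j l m. c * \<phi> k j l m) (tangent_part n d j l m)"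

definition torus_weight :: "nat \<Rightarrow> nat \<Rightarrow> nat \<Rightarrow> nat \<Rightarrow> int \<Rightarrow> scalar" where
  "torus_weight n N j l m = tt n l ^ 2 / tt n j ^ 2 * vv N powi (- 2 * m)"

text \<open>The product of \<open>(1 - w)\<^bsup>-1\<^esup>\<close> over the weights of the tangent space.\<close>

definition fp_coeff :: "nat \<Rightarrow> nat \<Rightarrow> fixed_point \<Rightarrow> scalar" where
  "fp_coeff n N d =
     (\<Prod>(j, l, m) \<in> {(j, l, m). tangent_mult n d j l m \<noteq> 0}.
        inverse (1 - torus_weight n N j l m) ^ tangent_mult n d j l m)"

text \<open>
  The class of the structure sheaf of the component of degree \<open>ds\<close>, expanded by localization,
  and the sum of all these classes.
\<close>

definition structure_sheaf :: "nat \<Rightarrow> nat \<Rightarrow> (nat \<Rightarrow> nat) \<Rightarrow> kvec" where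
  "structure_sheaf n N ds = (\<lambda>d. if d \<in> fixed_points n \<and> deg d = ds then fp_coeff n N d else 0)"

definition whittaker :: "nat \<Rightarrow> nat \<Rightarrow> kvec" where
  "whittaker n N = (\<lambda>d. structure_sheaf n N (deg d) d)"


subsection \<open>Operators\<close>

definition ss :: "nat \<Rightarrow> nat \<Rightarrow> fixed_point \<Rightarrow> nat \<Rightarrow> nat \<Rightarrow> scalar" where
  "ss n N d i j = tt n j ^ 2 * vv N powi (- 2 * int (d i j))"

text \<open>Matrix coefficient of \<open>p\<^sub>* q\<^sup>*\<close> from \<open>[d]\<close> to \<open>[d - \<delta>\<^sub>i\<^sub>j]\<close>, as given by the fixed point formula.\<close>

definition pq_coeff :: "nat \<Rightarrow> nat \<Rightarrow> nat \<Rightarrow> fixed_point \<Rightarrow> nat \<Rightarrow> scalar" where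
  "pq_coeff n N i d j = inverse (1 - vv N ^ 2) *
     (\<Prod>k\<in>{1..i} - {j}. inverse (1 - ss n N d i k / ss n N d i j)) *
     (\<Prod>k=1..i+1. 1 - ss n N d (i + 1) k / ss n N d i j)"

text \<open>
  Matrix coefficient of \<open>e\<^sub>i\<^sub>,\<^sub>r\<close> from \<open>[d]\<close> to \<open>[d - \<delta>\<^sub>i\<^sub>j]\<close>.  The fiber of the line bundle at this pair
  of fixed points is spanned by \<open>z\<^bsup>d\<^sub>i\<^sub>j-1\<^esup> w\<^sub>j\<close>, of weight \<open>v\<^sup>2 s\<^sub>i\<^sub>j\<close>.
\<close>

definition e_coeff :: "nat \<Rightarrow> nat \<Rightarrow> nat \<Rightarrow> int \<Rightarrow> fixed_point \<Rightarrow> nat \<Rightarrow> scalar" where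
  "e_coeff n N i r d j =
     inverse (tt n (i + 1)) * vv N powi (int (deg d (i + 1)) - int (deg d i) + 1 - int i) *
     (vv N ^ (i + 2) * ss n N d i j) powi r * pq_coeff n N i d j"

definition add_box :: "fixed_point \<Rightarrow> nat \<Rightarrow> nat \<Rightarrow> fixed_point" where
  "add_box d i j = d(i := (d i)(j := d i j + 1))"

text \<open>
  The operator lowers the degree by one step in direction \<open>i\<close>, so it extends to the product: the
  coordinate of the image at \<open>d\<close> receives contributions only from the fixed points \<open>d + \<delta>\<^sub>i\<^sub>j\<close>.
\<close>

definition e_op :: "nat \<Rightarrow> nat \<Rightarrow> nat \<Rightarrow> int \<Rightarrow> kvec \<Rightarrow> kvec" where
  "e_op n N i r x = (\<lambda>d. if d \<in> fixed_points n then
       (\<Sum>j \<in> {j \<in> {1..i}. add_box d i j \<in> fixed_points n}.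
          e_coeff n N i r (add_box d i j) j * x (add_box d i j))
     else 0)"

definition L_eigenvalue :: "nat \<Rightarrow> nat \<Rightarrow> nat \<Rightarrow> fixed_point \<Rightarrow> scalar" where
  "L_eigenvalue n N i d =
     (\<Prod>k=1..i. tt n k) * vv N powi (int (i * (i - 1) div 2) - int (deg d i))"

text \<open>\<open>L_pow n N i p\<close> is the \<open>p\<close>-th power of the diagonal operator \<open>L\<^sub>i\<close>, for any integer \<open>p\<close>.\<close>

definition L_pow :: "nat \<Rightarrow> nat \<Rightarrow> nat \<Rightarrow> int \<Rightarrow> kvec \<Rightarrow> kvec" where
  "L_pow n N i p x = (\<lambda>d. L_eigenvalue n N i d powi p * x d)"

end

theory Submission
  imports Defs "HOL-Computational_Algebra.Polynomial"
begin

text \<open>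
  The tangent space at a fixed point is the kernel of a surjection from the sum over \<open>k\<close> of the
  \<open>Hom(W\<^sub>k, (W \<otimes> O)/W\<^sub>k)\<close> to the sum of the \<open>Hom(W\<^sub>k, (W \<otimes> O)/W\<^sub>k\<^sub>+\<^sub>1)\<close>, which expresses its weights by
  those of the Hom spaces.  Most factors cancel when a box \<open>\<delta>\<^sub>i\<^sub>p\<close> is added to \<open>d\<close>, and \<open>a\<^bsub>d + \<delta>\<^esub>\<close>
  times the matrix coefficient of \<open>p\<^sub>* q\<^sup>*\<close> equals \<open>a\<^sub>d / (1 - v\<^sup>2)\<close> times the product of the
  \<open>1 / (1 - s\<^sub>i\<^sub>p/s\<^sub>i\<^sub>k)\<close>, \<open>k \<noteq> p\<close>, \<open>k \<le> i\<close>, and the \<open>1 - s\<^sub>i\<^sub>p/s\<^sub>i\<^sub>-\<^sub>1\<^sub>,\<^sub>k\<close>, \<open>k \<le> i - 1\<close>.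
  Put \<open>P(x) = \<Prod>\<^sub>k (1 - x/s\<^sub>i\<^sub>-\<^sub>1\<^sub>,\<^sub>k)\<close>, of degree \<open>i - 1\<close>.  Up to powers of \<open>t\<close> and \<open>v\<close> which are
  contributed by the operators \<open>L\<close>, the two identities are Lagrange interpolation of \<open>P\<close> at the \<open>i\<close>
  points \<open>s\<^sub>i\<^sub>1, \<dots>, s\<^sub>i\<^sub>i\<close>, read off at \<open>x = 0\<close> and at the leading coefficient.
\<close>

subsection \<open>Dimensions of weight spaces\<close>

text \<open>
  A weight space of the tangent space is a space of functions on a finite subset \<open>K\<close> of a path,
  extended by zero and constant along the edges \<open>k \<rightarrow> k + 1\<close>, \<open>k \<in> R\<close>.  If every edge has its left
  (right) end in \<open>K\<close>, the values at the right (left) ends of the components contained in \<open>K\<close> are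
  coordinates, whence the dimension is \<open>card K - card R\<close>.
\<close>

definition path_fun :: "nat set \<Rightarrow> nat set \<Rightarrow> (nat \<Rightarrow> complex) set" where
  "path_fun K R = {f. (\<forall>k. k \<notin> K \<longrightarrow> f k = 0) \<and> (\<forall>k\<in>R. f k = f (Suc k))}"

text \<open>The functions \<open>b t\<close> are dual to the evaluations at points of
  \<open>T\<close>, and an element vanishing on \<open>T\<close> is zero. Evaluating on
  \<open>T\<close> therefore yields both independence and spanning once a vector space structure is
  present.\<close>

lemma path_fun_basis:
  assumes fin: "finite K" and sub: "R \<subseteq> K \<or> Suc ` R \<subseteq> K"
  obtains T b where "T \<subseteq> K" "card T + card R = card K"
    "\<And>t. t \<in> T \<Longrightarrow> b t \<in> path_fun K R"
    "\<And>s t. s \<in> T \<Longrightarrow> t \<in> T \<Longrightarrow> b t s = (if s = t then 1 else 0)"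
    "\<And>f k. f \<in> path_fun K R \<Longrightarrow> (\<And>t. t \<in> T \<Longrightarrow> f t = 0) \<Longrightarrow> f k = 0"
proof -
  from sub consider (up) "R \<subseteq> K" | (down) "Suc ` R \<subseteq> K" by blast
  then show thesis
  proof cases
    case up
    \<comment> \<open>The points of \<open>K - R\<close> are the right ends of the components that
      meet the support, and \<open>b t\<close> is the indicator of the component ending at
      \<open>t\<close>. Since \<open>R \<subseteq> K\<close>, all its vertices to the left of
      \<open>t\<close> lie in \<open>K\<close>.\<close>
    define b :: "nat \<Rightarrow> nat \<Rightarrow> complex"
      where "b t k = (if k \<le> t \<and> (\<forall>i. k \<le> i \<and> i < t \<longrightarrow> i \<in> R) then 1 else 0)" for t k
    show thesis
    proof (rule that[of "K - R" b])
      show "card (K - R) + card R = card K"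
        using up fin by (metis card_Diff_subset card_mono finite_subset le_add_diff_inverse2)
      show "b t \<in> path_fun K R" if "t \<in> K - R" for t
      proof -
        have "b t k = 0" if "k \<notin> K" for k
          using that up \<open>t \<in> K - R\<close> unfolding b_def
          by (metis (no_types, lifting) DiffD1 in_mono le_less order_refl)
        moreover have "b t k = b t (Suc k)" if "k \<in> R" for k
        proof -
          have "k \<noteq> t" using that \<open>t \<in> K - R\<close> by auto
          then have "k \<le> t \<longleftrightarrow> Suc k \<le> t" by auto
          moreover have "(\<forall>i. k \<le> i \<and> i < t \<longrightarrow> i \<in> R) \<longleftrightarrow> (\<forall>i. Suc k \<le> i \<and> i < t \<longrightarrow> i \<in> R)"
            using that by (metis Suc_leD Suc_leI le_neq_implies_less)
          ultimately show ?thesis unfolding b_def by simp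
        qed
        ultimately show ?thesis by (auto simp: path_fun_def)
      qed
      show "b t s = (if s = t then 1 else 0)" if "s \<in> K - R" "t \<in> K - R" for s t
        using that by (auto simp: b_def)
      fix f k assume f: "f \<in> path_fun K R" and z: "\<And>t. t \<in> K - R \<Longrightarrow> f t = 0"
      \<comment> \<open>Beyond \<open>u\<close> everything vanishes, so induction can run from right
        to left: along an edge the value at \<open>k\<close> is that at
        \<open>Suc k\<close>.\<close>
      obtain u where u: "\<And>k. k \<in> K \<Longrightarrow> k < u" using fin finite_nat_set_iff_bounded by auto
      show "f k = 0"
      proof (induction "u - k" arbitrary: k rule: less_induct)
        case less
        show ?case
        proof (cases "k \<in> R")
          case True
          then have "f (Suc k) = 0" using u[of k] up by (intro less) auto
          then show ?thesis using f True by (auto simp: path_fun_def)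
        next
          case False
          then show ?thesis using f z by (cases "k \<in> K") (auto simp: path_fun_def)
        qed
      qed
    qed auto
  next
    case down
    \<comment> \<open>Mirror image of the first case: the chosen points are the vertices of
      \<open>K\<close> without an incoming edge, and \<open>b t\<close> is the indicator of the
      component starting at \<open>t\<close>.\<close>
    define b :: "nat \<Rightarrow> nat \<Rightarrow> complex"
      where "b t k = (if t \<le> k \<and> (\<forall>i. t \<le> i \<and> i < k \<longrightarrow> i \<in> R) then 1 else 0)" for t k
    show thesis
    proof (rule that[of "K - Suc ` R" b])
      have "card (Suc ` R) = card R" by (simp add: card_image)
      moreover have "card (Suc ` R) \<le> card K" using down fin by (simp add: card_mono)
      ultimately show "card (K - Suc ` R) + card R = card K"
        using down fin by (simp add: card_Diff_subset finite_subset)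
      show "b t \<in> path_fun K R" if "t \<in> K - Suc ` R" for t
      proof -
        have "b t k = 0" if k: "k \<notin> K" for k
        proof (rule ccontr)
          assume "b t k \<noteq> 0"
          then have *: "t \<le> k" "\<And>i. t \<le> i \<Longrightarrow> i < k \<Longrightarrow> i \<in> R" by (auto simp: b_def split: if_splits)
          have "t \<noteq> k" using k \<open>t \<in> K - Suc ` R\<close> by auto
          then have "k - 1 \<in> R" "k = Suc (k - 1)" using * by auto
          then show False using k down by (metis image_subset_iff)
        qed
        moreover have "b t k = b t (Suc k)" if "k \<in> R" for k
        proof -
          have "Suc k \<noteq> t" using that \<open>t \<in> K - Suc ` R\<close> by auto
          then have "t \<le> k \<longleftrightarrow> t \<le> Suc k" by auto
          moreover have "(\<forall>i. t \<le> i \<and> i < k \<longrightarrow> i \<in> R) \<longleftrightarrow> (\<forall>i. t \<le> i \<and> i < Suc k \<longrightarrow> i \<in> R)"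
            using that by (metis less_Suc_eq)
          ultimately show ?thesis unfolding b_def by simp
        qed
        ultimately show ?thesis by (auto simp: path_fun_def)
      qed
      show "b t s = (if s = t then 1 else 0)" if "s \<in> K - Suc ` R" "t \<in> K - Suc ` R" for s t
      proof (cases "t < s")
        case True
        then have "s = Suc (s - 1)" "t \<le> s - 1" "s - 1 < s" by auto
        moreover from this have "s - 1 \<notin> R" using that by (metis DiffE imageI)
        ultimately have "b t s = 0" unfolding b_def by meson
        then show ?thesis using True by simp
      qed (auto simp: b_def)
      fix f k assume f: "f \<in> path_fun K R" and z: "\<And>t. t \<in> K - Suc ` R \<Longrightarrow> f t = 0"
      show "f k = 0"
      proof (induction k rule: less_induct)
        case (less k)
        show ?case
        proof (cases "k \<in> Suc ` R")
          case True
          then show ?thesis using f less by (auto simp: path_fun_def)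
        next
          case False
          then show ?thesis using f z by (cases "k \<in> K") (auto simp: path_fun_def)
        qed
      qed
    qed auto
  qed
qed

section \<open>Multiplicities of tangent weights\<close>

interpretation tangent: vector_space
  "\<lambda>(c::complex) (\<phi> :: nat \<Rightarrow> nat \<Rightarrow> nat \<Rightarrow> int \<Rightarrow> complex) k j l m. c * \<phi> k j l m"
  by unfold_locales (auto simp: fun_eq_iff algebra_simps)

text \<open>
  The indices \<open>k\<close> whose compatibility condition in degree \<open>(j, l, m)\<close> is nonvacuous: those for which
  \<open>w\<^sub>j \<mapsto> z\<^sup>m w\<^sub>l\<close> is a nonzero homomorphism from \<open>W\<^sub>k\<close> to \<open>(W \<otimes> O)/W\<^sub>k\<^sub>+\<^sub>1\<close>.
\<close>

definition hom_edges :: "nat \<Rightarrow> fixed_point \<Rightarrow> nat \<Rightarrow> nat \<Rightarrow> int \<Rightarrow> nat set" where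
  "hom_edges n d j l m = {k. 1 \<le> j \<and> j \<le> k \<and> k + 1 \<le> n - 1 \<and> 1 \<le> l \<and> l \<le> n \<and> - int (d k j) \<le> m \<and>
     (if l \<le> k + 1 then m < int (d (k + 1) l) - int (d k j) else m < 0)}"

definition embed_weight ::
    "nat \<Rightarrow> nat \<Rightarrow> int \<Rightarrow> (nat \<Rightarrow> complex) \<Rightarrow> nat \<Rightarrow> nat \<Rightarrow> nat \<Rightarrow> int \<Rightarrow> complex" where
  "embed_weight j l m f = (\<lambda>k j' l' m'. if (j', l', m') = (j, l, m) then f k else 0)"

text \<open>Rows beyond \<open>n - 1\<close> are zero, so monotonicity extends to them; row
  \<open>i + 1\<close> with \<open>i = n - 1\<close> does occur later.\<close>

lemma fixed_points_antimono:
  assumes "d \<in> fixed_points n" "1 \<le> j" "j \<le> k" "k \<le> i"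
  shows "d i j \<le> d k j"
proof (cases "i \<le> n - 1")
  case True
  then show ?thesis using assms unfolding fixed_points_def by blast
next
  case False
  then have "d i j = 0" using assms unfolding fixed_points_def by blast
  then show ?thesis by simp
qed

text \<open>The compatibility condition is also imposed where \<open>k\<close> is not an edge,
  namely for \<open>m < - d k j\<close>, or for \<open>m \<ge> 0\<close> when
  \<open>l > k + 1\<close>. There both \<open>\<phi> k\<close> and \<open>\<phi> (k + 1)\<close>
  vanish anyway, so only the edges remain as conditions.\<close>

lemma tangent_part_eq:
  assumes d: "d \<in> fixed_points n"
  shows "tangent_part n d j l m =
    embed_weight j l m ` path_fun {k. hom_monomial n d k j l m} (hom_edges n d j l m)"
    (is "?L = ?e ` ?P")
proof (intro equalityI subsetI)
  fix \<phi> assume \<phi>: "\<phi> \<in> ?L"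
  have "\<phi> = ?e (\<lambda>k. \<phi> k j l m)"
    using \<phi> by (fastforce simp: embed_weight_def tangent_part_def fun_eq_iff)
  moreover have "(\<lambda>k. \<phi> k j l m) \<in> ?P"
    using \<phi> by (auto simp: tangent_part_def tangent_space_def path_fun_def hom_edges_def split: if_splits)
  ultimately show "\<phi> \<in> ?e ` ?P" by blast
next
  fix \<phi> assume "\<phi> \<in> ?e ` ?P"
  then obtain f where f: "f \<in> ?P" and \<phi>: "\<phi> = ?e f" by blast
  have "f k = f (k + 1)"
    if k: "1 \<le> j" "j \<le> k" "k + 1 \<le> n - 1" "1 \<le> l" "l \<le> n"
      "l \<le> k + 1 \<longrightarrow> int (d k j) + m < int (d (k + 1) l)" for k
  proof (cases "k \<in> hom_edges n d j l m")
    case True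
    then show ?thesis using f by (auto simp: path_fun_def)
  next
    case False
    have "d (k + 1) j \<le> d k j" using fixed_points_antimono[OF d] k by simp
    then have "\<not> hom_monomial n d k j l m" "\<not> hom_monomial n d (k + 1) j l m"
      using False k by (auto simp: hom_edges_def hom_monomial_def split: if_splits)
    then show ?thesis using f by (auto simp: path_fun_def)
  qed
  then show "\<phi> \<in> ?L" using f
    by (auto simp: \<phi> tangent_part_def tangent_space_def embed_weight_def path_fun_def)
qed

lemma sum_fun4_apply: "(\<Sum>x\<in>A. f x) k j l m = (\<Sum>x\<in>A. f x k j l m)"
  for f :: "'a \<Rightarrow> nat \<Rightarrow> nat \<Rightarrow> nat \<Rightarrow> int \<Rightarrow> complex"
  by (induction A rule: infinite_finite_induct) auto

lemma finite_hom_monomial: "finite {k. hom_monomial n d k j l m}"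
  by (rule finite_subset[of _ "{..n}"]) (auto simp: hom_monomial_def)

text \<open>Rank-nullity in a single weight, surjectivity onto the edge conditions included: the
  vertices of the path are the Hom monomials, and the dimension is the number of vertices minus that
  of edges. Stating it as a sum avoids truncated subtraction.\<close>

lemma tangent_mult_eq:
  assumes d: "d \<in> fixed_points n"
  shows "tangent_mult n d j l m + card (hom_edges n d j l m) = card {k. hom_monomial n d k j l m}"
proof -
  let ?K = "{k. hom_monomial n d k j l m}" and ?R = "hom_edges n d j l m"
  have mono: "d (k + 1) l \<le> d k l" if "1 \<le> l" "l \<le> k" for k l
    using fixed_points_antimono[OF d] that by simp
  have sub: "?R \<subseteq> ?K \<or> Suc ` ?R \<subseteq> ?K"
  \<comment> \<open>For \<open>m < 0\<close> the left end of every edge is a Hom monomial, also when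
    \<open>l = k + 1\<close>, where its upper bound is 0. For \<open>m \<ge> 0\<close> an edge
    forces \<open>l \<le> k + 1\<close>, and the right end is a Hom monomial since its lower bound
    is at most 0.\<close>
  proof (cases "m < 0")
    case True
    have "?R \<subseteq> ?K"
      using mono[of l] True by (fastforce simp: hom_edges_def hom_monomial_def split: if_splits)
    then show ?thesis ..
  next
    case False
    have "Suc ` ?R \<subseteq> ?K"
      using mono[of j] False by (fastforce simp: hom_edges_def hom_monomial_def split: if_splits)
    then show ?thesis ..
  qed
  obtain T b where T: "T \<subseteq> ?K" "card T + card ?R = card ?K"
    "\<And>t. t \<in> T \<Longrightarrow> b t \<in> path_fun ?K ?R"
    "\<And>s t. s \<in> T \<Longrightarrow> t \<in> T \<Longrightarrow> b t s = (if s = t then 1 else 0)"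
    "\<And>f k. f \<in> path_fun ?K ?R \<Longrightarrow> (\<And>t. t \<in> T \<Longrightarrow> f t = 0) \<Longrightarrow> f k = 0"
    by (fact path_fun_basis[OF finite_hom_monomial sub])
  have finT: "finite T" using T(1) finite_hom_monomial finite_subset by blast
  let ?e = "embed_weight j l m"
  define B where "B = (\<lambda>t. ?e (b t)) ` T"
  have inj: "inj_on (\<lambda>t. ?e (b t)) T"
  proof (rule inj_onI)
    fix s t assume st: "s \<in> T" "t \<in> T" "?e (b s) = ?e (b t)"
    then have "?e (b s) s j l m = ?e (b t) s j l m" by simp
    then show "s = t" using T(4) st(1,2) by (simp add: embed_weight_def split: if_splits)
  qed
  have "tangent.dim (tangent_part n d j l m) = card T"
  proof (rule tangent.dim_unique[of B])
    show "B \<subseteq> tangent_part n d j l m" using T(3) by (auto simp: B_def tangent_part_eq[OF d])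
    show "card B = card T" unfolding B_def by (rule card_image[OF inj])
    show "tangent_part n d j l m \<subseteq> tangent.span B"
    proof
      fix \<phi> assume "\<phi> \<in> tangent_part n d j l m"
      then obtain f where f: "f \<in> path_fun ?K ?R" and \<phi>: "\<phi> = ?e f"
        unfolding tangent_part_eq[OF d] by blast
      \<comment> \<open>Subtracting the combination of the \<open>b t\<close> with the same values
        on \<open>T\<close> leaves an element vanishing on \<open>T\<close>, hence zero.\<close>
      define g where "g = (\<lambda>k. f k - (\<Sum>t\<in>T. f t * b t k))"
      have "g \<in> path_fun ?K ?R"
        unfolding g_def using f T(3) by (simp add: path_fun_def)
      moreover have "g t = 0" if "t \<in> T" for t
      proof -
        have "(\<Sum>s\<in>T. f s * b s t) = (\<Sum>s\<in>T. if s = t then f t else 0)"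
          using T(4) that by (intro sum.cong) auto
        then show ?thesis using that finT by (simp add: g_def)
      qed
      ultimately have g0: "g k = 0" for k using T(5) by blast
      obtain c where "f = (\<lambda>k. \<Sum>t\<in>T. c t * b t k)"
      proof
        show "f = (\<lambda>k. \<Sum>t\<in>T. f t * b t k)"
        proof
          fix k
          show "f k = (\<Sum>t\<in>T. f t * b t k)"
            using g0[of k] unfolding g_def right_minus_eq .
        qed
      qed
      then have "\<phi> = (\<Sum>t\<in>T. (\<lambda>k j' l' m'. c t * ?e (b t) k j' l' m'))"
        by (auto simp: \<phi> fun_eq_iff sum_fun4_apply embed_weight_def intro!: sum.neutral)
      also have "\<dots> \<in> tangent.span B"
        by (intro tangent.span_sum tangent.span_scale tangent.span_base) (auto simp: B_def)
      finally show "\<phi> \<in> tangent.span B" .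
    qed
    show "tangent.independent B"
    proof (rule tangent.independent_if_scalars_zero)
      show "finite B" using finT by (simp add: B_def)
      fix c x assume s: "(\<Sum>x\<in>B. (\<lambda>k j l m. c x * x k j l m)) = 0" and "x \<in> B"
      then obtain t where t: "t \<in> T" "x = ?e (b t)" by (auto simp: B_def)
      have "0 = (\<Sum>x\<in>B. (\<lambda>k j l m. c x * x k j l m)) t j l m" by (simp add: s)
      also have "\<dots> = (\<Sum>s\<in>T. c (?e (b s)) * b s t)"
        unfolding B_def sum.reindex[OF inj] sum_fun4_apply by (simp add: embed_weight_def)
      also have "\<dots> = (\<Sum>s\<in>T. if s = t then c (?e (b t)) else 0)"
        using T(4) t(1) by (intro sum.cong) auto
      finally show "c x = 0" using t finT by simp
    qed
  qed
  then show ?thesis using T(2) unfolding tangent_mult_def by simp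
qed


subsection \<open>Torus weights\<close>

text \<open>Torus characters as elements of the field. A character is trivial only if its exponent
  vector is zero, so weights can be compared by their exponents.\<close>

definition laurent_monom :: "(nat \<Rightarrow>\<^sub>0 int) \<Rightarrow> scalar" where
  "laurent_monom e = Fract (Poly_Mapping.single e 1) 1"

lemma laurent_monom_0 [simp]: "laurent_monom 0 = 1"
  by (simp add: laurent_monom_def One_fract_def)

lemma laurent_monom_add: "laurent_monom (a + b) = laurent_monom a * laurent_monom b"
  by (simp add: laurent_monom_def mult_single)

lemma laurent_monom_eq_1_iff: "laurent_monom e = 1 \<longleftrightarrow> e = 0"
proof
  assume "laurent_monom e = 1"
  then have "Poly_Mapping.single e (1::complex) = Poly_Mapping.single 0 1"
    by (simp add: laurent_monom_def One_fract_def eq_fract)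
  then have "Poly_Mapping.keys (Poly_Mapping.single e (1::complex)) =
      Poly_Mapping.keys (Poly_Mapping.single (0 :: nat \<Rightarrow>\<^sub>0 int) (1::complex))" by (rule arg_cong)
  then show "e = 0" by simp
qed simp

lemma laurent_monom_uminus: "laurent_monom (- e) = inverse (laurent_monom e)"
proof -
  have "laurent_monom (- e) * laurent_monom e = 1" by (simp flip: laurent_monom_add)
  then show ?thesis by (metis inverse_unique mult.commute)
qed

lemma laurent_monom_neq_0 [simp]: "laurent_monom e \<noteq> 0"
  using laurent_monom_add[of e "- e"] by auto

lemma laurent_monom_diff: "laurent_monom (a - b) = laurent_monom a / laurent_monom b"
  using laurent_monom_add[of a "- b"] by (simp add: laurent_monom_uminus divide_inverse)

lemma laurent_monom_sum: "laurent_monom (sum f A) = (\<Prod>x\<in>A. laurent_monom (f x))"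
  by (induction A rule: infinite_finite_induct) (auto simp: laurent_monom_add)

lemma indet_eq_laurent_monom: "indet i = laurent_monom (Poly_Mapping.single i 1)"
  by (simp add: indet_def laurent_monom_def)

lemma laurent_monom_single_nat: "laurent_monom (Poly_Mapping.single i (int k)) = indet i ^ k"
proof (induction k)
  case (Suc k)
  have "Poly_Mapping.single i (int (Suc k)) = Poly_Mapping.single i 1 + Poly_Mapping.single i (int k)"
    by (simp flip: single_add)
  then show ?case using Suc by (simp add: laurent_monom_add indet_eq_laurent_monom)
qed simp

lemma laurent_monom_single: "laurent_monom (Poly_Mapping.single i k) = indet i powi k"
proof (cases "k \<ge> 0")
  case True
  then show ?thesis using laurent_monom_single_nat[of i "nat k"] by (simp add: power_int_def)
next
  case False
  then have "laurent_monom (Poly_Mapping.single i (- k)) = indet i ^ nat (- k)"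
    using laurent_monom_single_nat[of i "nat (- k)"] by simp
  then show ?thesis using False laurent_monom_uminus[of "Poly_Mapping.single i (- k)"]
    by (simp add: power_int_def single_uminus power_inverse)
qed

lemma indet_neq_0 [simp]: "indet i \<noteq> 0"
  by (simp add: indet_eq_laurent_monom)

lemma vv_neq_0 [simp]: "vv N \<noteq> 0"
  by (simp add: vv_def)

lemma tt_neq_0 [simp]: "tt n j \<noteq> 0"
  by (simp add: tt_def)

definition tt_exponent :: "nat \<Rightarrow> nat \<Rightarrow> nat \<Rightarrow>\<^sub>0 int" where
  "tt_exponent n j =
     (if j < n then Poly_Mapping.single j 1 else - (\<Sum>i=1..<n. Poly_Mapping.single i 1))"

lemma tt_eq_laurent_monom: "tt n j = laurent_monom (tt_exponent n j)"
  by (simp add: tt_def tt_exponent_def laurent_monom_uminus laurent_monom_sum indet_eq_laurent_monom)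

lemma vv_powi_eq_laurent_monom: "vv N powi m = laurent_monom (Poly_Mapping.single 0 (int N * m))"
  by (simp add: laurent_monom_single vv_def power_int_mult)

lemma torus_weight_eq_laurent_monom:
  "torus_weight n N j l m = laurent_monom (tt_exponent n l + tt_exponent n l - (tt_exponent n j + tt_exponent n j)
     + Poly_Mapping.single 0 (int N * (- 2 * m)))"
  unfolding torus_weight_def tt_eq_laurent_monom vv_powi_eq_laurent_monom laurent_monom_add laurent_monom_diff
  by (simp add: power2_eq_square)

lemma lookup_tt_exponent:
  "Poly_Mapping.lookup (tt_exponent n j) i =
     (if j < n then (if i = j then 1 else 0) else if 1 \<le> i \<and> i < n then -1 else 0)"
proof -
  have "(\<Sum>k=1..<n. Poly_Mapping.lookup (Poly_Mapping.single k (1::int)) i) =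
      (\<Sum>k=1..<n. if k = i then 1 else 0)"
    by (intro sum.cong) (auto simp: lookup_single when_def)
  also have "\<dots> = (if 1 \<le> i \<and> i < n then 1 else 0)" by simp
  finally show ?thesis
    by (auto simp: tt_exponent_def lookup_single lookup_sum when_def)
qed

text \<open>Coordinate 0 of the exponent is \<open>- 2 * N * m\<close>, which gives
  \<open>m = 0\<close> because \<open>N > 0\<close>. Coordinates \<open>j\<close> and
  \<open>l\<close> then separate the \<open>t\<close>-parts; \<open>t_n\<close> is distinguished by
  its entries -1.\<close>

lemma torus_weight_neq_1:
  assumes "N > 0" "j \<in> {1..n}" "l \<in> {1..n}" "\<not> (j = l \<and> m = 0)"
  shows "torus_weight n N j l m \<noteq> 1"
proof
  assume "torus_weight n N j l m = 1"
  then have "Poly_Mapping.lookup (tt_exponent n l + tt_exponent n l - (tt_exponent n j + tt_exponent n j)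
     + Poly_Mapping.single 0 (int N * (- 2 * m))) i = 0" for i
    unfolding torus_weight_eq_laurent_monom laurent_monom_eq_1_iff by simp
  note z = this[unfolded lookup_add lookup_minus lookup_tt_exponent lookup_single when_def]
  have "m = 0" using z[of 0] assms(1-3) by (auto split: if_splits)
  moreover have "j = l" using z[of j] z[of l] assms(2,3) by (auto split: if_splits)
  ultimately show False using assms(4) by blast
qed

section \<open>Products of tangent weights by telescoping\<close>

text \<open>
  The trivial weight is not a tangent weight; setting its factor to 1 makes all factors invertible, so
  that products over intervals of \<open>m\<close> become quotients of values of \<open>signed_prod\<close>.
\<close>

definition weight_factor :: "nat \<Rightarrow> nat \<Rightarrow> nat \<Rightarrow> nat \<Rightarrow> int \<Rightarrow> scalar" where
  "weight_factor n N j l m = (if j = l \<and> m = 0 then 1 else 1 - torus_weight n N j l m)"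

lemma weight_factor_neq_0:
  assumes "N > 0" "j \<in> {1..n}" "l \<in> {1..n}"
  shows "weight_factor n N j l m \<noteq> 0"
  using torus_weight_neq_1[OF assms] by (auto simp: weight_factor_def)

text \<open>A multiplicative antiderivative of \<open>f\<close>, normalized to 1 at 0. For factors
  \<open>1 - c * q ^ m\<close> it is the q-Pochhammer symbol extended to negative length.\<close>

definition signed_prod :: "(int \<Rightarrow> 'a::field) \<Rightarrow> int \<Rightarrow> 'a" where
  "signed_prod f b = (if 0 \<le> b then \<Prod>m\<in>{0..<b}. f m else inverse (\<Prod>m\<in>{b..<0}. f m))"

lemma signed_prod_0 [simp]: "signed_prod f 0 = 1"
  by (simp add: signed_prod_def)

lemma signed_prod_neq_0: "(\<And>m. f m \<noteq> 0) \<Longrightarrow> signed_prod f b \<noteq> 0"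
  by (simp add: signed_prod_def)

lemma signed_prod_add_1:
  assumes "f b \<noteq> 0"
  shows "signed_prod f (b + 1) = signed_prod f b * f b"
proof (cases "0 \<le> b")
  case True
  then have "{0..<b + 1} = insert b {0..<b}" by auto
  then show ?thesis using True by (simp add: signed_prod_def)
next
  case False
  then have "{b..<0} = insert b {b + 1..<0}" by auto
  then have "(\<Prod>m\<in>{b..<0}. f m) = f b * (\<Prod>m\<in>{b + 1..<0}. f m)" by simp
  then show ?thesis using False assms by (cases "b = -1") (auto simp: signed_prod_def)
qed

lemma prod_eq_signed_prod:
  assumes f: "\<And>m. f m \<noteq> 0" and "a \<le> b"
  shows "(\<Prod>m\<in>{a..<b}. f m) = signed_prod f b / signed_prod f a"
  using \<open>a \<le> b\<close>
proof (induction b rule: int_ge_induct)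
  case base
  then show ?case using signed_prod_neq_0[of f] f by simp
next
  case (step b)
  then have "{a..<b + 1} = insert b {a..<b}" by auto
  then show ?case using step f by (simp add: signed_prod_add_1)
qed

abbreviation (input) "weight_prod n N j l \<equiv> signed_prod (weight_factor n N j l)"

text \<open>For Hom monomials and for edges \<open>m\<close> runs over intervals with the same lower
  end \<open>- d k j\<close>, whose contribution cancels in the quotient. An upper end 0 contributes
  1, which explains the trivial cases.\<close>

lemma hom_weights_quotient:
  assumes d: "d \<in> fixed_points n" and "N > 0" and k: "1 \<le> k" "k \<le> n - 1"
    and j: "1 \<le> j" "j \<le> k" and l: "1 \<le> l" "l \<le> n" and "finite M"
    and K: "\<And>m. hom_monomial n d k j l m \<Longrightarrow> m \<in> M"
    and R: "\<And>m. k \<in> hom_edges n d j l m \<Longrightarrow> m \<in> M"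
  shows "(\<Prod>m\<in>M. if hom_monomial n d k j l m then weight_factor n N j l m else 1) /
      (\<Prod>m\<in>M. if k \<in> hom_edges n d j l m then weight_factor n N j l m else 1) =
    (if l \<le> k then weight_prod n N j l (int (d k l) - int (d k j)) else 1) /
    (if l \<le> k + 1 then weight_prod n N j l (int (d (k + 1) l) - int (d k j)) else 1)"
proof -
  let ?f = "weight_factor n N j l"
  let ?u = "if l \<le> k then int (d k l) - int (d k j) else 0"
  let ?w = "if l \<le> k + 1 then int (d (k + 1) l) - int (d k j) else 0"
  have f: "?f m \<noteq> 0" for m using weight_factor_neq_0[of N j n l m] assms by auto
  have s: "signed_prod ?f b \<noteq> 0" for b by (rule signed_prod_neq_0[OF f])
  have "(\<Prod>m\<in>M. if hom_monomial n d k j l m then ?f m else 1) =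
      prod ?f {m \<in> M. hom_monomial n d k j l m}"
    using \<open>finite M\<close> by (simp add: prod.inter_filter)
  also have "{m \<in> M. hom_monomial n d k j l m} = {- int (d k j)..<?u}"
    using K assms(2-8) by (auto simp: hom_monomial_def split: if_splits)
  also have "prod ?f \<dots> = signed_prod ?f ?u / signed_prod ?f (- int (d k j))"
    by (rule prod_eq_signed_prod[OF f]) auto
  finally have 1: "(\<Prod>m\<in>M. if hom_monomial n d k j l m then ?f m else 1) =
      signed_prod ?f ?u / signed_prod ?f (- int (d k j))" .
  have 2: "(\<Prod>m\<in>M. if k \<in> hom_edges n d j l m then ?f m else 1) =
      signed_prod ?f ?w / signed_prod ?f (- int (d k j))"
  proof (cases "k + 1 \<le> n - 1")
    case True
    have "(\<Prod>m\<in>M. if k \<in> hom_edges n d j l m then ?f m else 1) =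
        prod ?f {m \<in> M. k \<in> hom_edges n d j l m}"
      using \<open>finite M\<close> by (simp add: prod.inter_filter)
    also have "{m \<in> M. k \<in> hom_edges n d j l m} = {- int (d k j)..<?w}"
      using R assms(2-8) True by (auto simp: hom_edges_def split: if_splits)
    also have "prod ?f \<dots> = signed_prod ?f ?w / signed_prod ?f (- int (d k j))"
      by (rule prod_eq_signed_prod[OF f]) auto
    finally show ?thesis .
  next
    case False
    \<comment> \<open>For \<open>k = n - 1\<close> there are no edges. The formula persists because
      row \<open>n\<close> is zero, so the upper end \<open>?w\<close> equals the lower end.\<close>
    then have "d (k + 1) l = 0" "l \<le> k + 1"
      using d k l by (auto simp: fixed_points_def)
    moreover have "k \<notin> hom_edges n d j l m" for m using False by (simp add: hom_edges_def)
    ultimately show ?thesis using s by simp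
  qed
  show ?thesis unfolding 1 2 using s by auto
qed

text \<open>Here and in \<open>edge_prod\<close> only the contributions of the upper ends of the
  intervals are kept; the lower ends cancel between the two.\<close>

definition hom_prod :: "nat \<Rightarrow> nat \<Rightarrow> fixed_point \<Rightarrow> nat \<Rightarrow> scalar" where
  "hom_prod n N d k = (\<Prod>j=1..k. \<Prod>l=1..k. weight_prod n N j l (int (d k l) - int (d k j)))"

definition edge_prod :: "nat \<Rightarrow> nat \<Rightarrow> fixed_point \<Rightarrow> nat \<Rightarrow> scalar" where
  "edge_prod n N d k =
     (\<Prod>j=1..k. \<Prod>l=1..k+1. weight_prod n N j l (int (d (k + 1) l) - int (d k j)))"

lemma power_card_eq_prod:
  assumes "finite A" "{k. P k} \<subseteq> A"
  shows "x ^ card {k. P k} = (\<Prod>k\<in>A. if P k then x else (1::'a::comm_monoid_mult))"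
proof -
  have "{k. P k} = {k \<in> A. P k}" using assms(2) by auto
  then show ?thesis using assms(1) by (simp add: prod.inter_filter flip: prod_constant)
qed

lemma prod_extend_by_one:
  fixes k n :: nat
  assumes "k \<le> n"
  shows "(\<Prod>l=1..n. if l \<le> k then f l else (1::'a::comm_monoid_mult)) = (\<Prod>l=1..k. f l)"
proof -
  have "(\<Prod>l=1..k. f l) = (\<Prod>l=1..k. if l \<le> k then f l else 1)" by (rule prod.cong) auto
  also have "\<dots> = (\<Prod>l=1..n. if l \<le> k then f l else 1)"
    using assms by (intro prod.mono_neutral_left) auto
  finally show ?thesis by simp
qed

text \<open>Each multiplicity is a number of \<open>k\<close> with a Hom monomial minus a number of
  edges. Writing the powers as products over \<open>k\<close> and exchanging the products leaves,
  for each \<open>k\<close>, the quotient computed in \<open>hom_weights_quotient\<close>.\<close>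

lemma fp_coeff_eq:
  assumes d: "d \<in> fixed_points n" and "N > 0"
  shows "inverse (fp_coeff n N d) = (\<Prod>k=1..n-1. hom_prod n N d k / edge_prod n N d k)"
proof -
  let ?W = "weight_factor n N"
  \<comment> \<open>\<open>D\<close> bounds all entries of \<open>d\<close>, so every exponent
    \<open>m\<close> that occurs lies between \<open>- D\<close> and \<open>D\<close>, and all
    products range over one finite box.\<close>
  define D where "D = int (\<Sum>k=0..n. \<Sum>j=0..n. d k j)"
  have D: "int (d k j) \<le> D" if "k \<le> n" "j \<le> n" for k j
  proof -
    have "d k j \<le> (\<Sum>j=0..n. d k j)" using that by (intro member_le_sum) auto
    also have "\<dots> \<le> (\<Sum>k=0..n. \<Sum>j=0..n. d k j)"
      using that by (intro member_le_sum[where f = "\<lambda>k. \<Sum>j=0..n. d k j"]) auto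
    finally show ?thesis unfolding D_def of_nat_le_iff .
  qed
  have "D \<ge> 0" unfolding D_def by (rule of_nat_0_le_iff)
  define M where "M = {- D..D}"
  define Box where "Box = {1..n} \<times> {1..n} \<times> M"
  have "finite M" "finite Box" by (simp_all add: M_def Box_def)
  have K: "(j, l, m) \<in> Box" if "hom_monomial n d k j l m" for k j l m
  proof -
    have "k \<le> n" "j \<le> n" "l \<le> n" using that by (auto simp: hom_monomial_def)
    then show ?thesis using that D[of k j] D[of k l] \<open>D \<ge> 0\<close>
      by (auto simp: hom_monomial_def Box_def M_def split: if_splits)
  qed
  have R: "(j, l, m) \<in> Box" if "k \<in> hom_edges n d j l m" for k j l m
  proof -
    have "k \<le> n" "k + 1 \<le> n" "j \<le> n" "l \<le> n" using that by (auto simp: hom_edges_def)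
    then show ?thesis using that D[of k j] D[of "k + 1" l] \<open>D \<ge> 0\<close>
      by (auto simp: hom_edges_def Box_def M_def split: if_splits)
  qed
  \<comment> \<open>For \<open>j = l\<close> the bound is \<open>m < 0\<close>, so the trivial
    weight has multiplicity 0 and its replacement by the factor 1 is harmless.\<close>
  have no_hom: "{k. hom_monomial n d k j l m} = {}" if "j = l \<and> m = 0" for j l m
    using that by (auto simp: hom_monomial_def)
  have W: "?W j l m \<noteq> 0" if "(j, l, m) \<in> Box" for j l m
    using weight_factor_neq_0[OF \<open>N > 0\<close>] that by (auto simp: Box_def)
  have "fp_coeff n N d = (\<Prod>(j, l, m)\<in>Box. inverse (1 - torus_weight n N j l m) ^ tangent_mult n d j l m)"
    unfolding fp_coeff_def
  proof (rule prod.mono_neutral_left)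
    show "{(j, l, m). tangent_mult n d j l m \<noteq> 0} \<subseteq> Box"
    proof safe
      fix j l m assume "0 < tangent_mult n d j l m"
      then have "{k. hom_monomial n d k j l m} \<noteq> {}"
        using tangent_mult_eq[OF d, of j l m] by (metis add_is_0 card.empty less_not_refl)
      then show "(j, l, m) \<in> Box" using K by blast
    qed
  qed (use \<open>finite Box\<close> in \<open>auto intro!: gr0I\<close>)
  also have "\<dots> = (\<Prod>(j, l, m)\<in>Box. ?W j l m ^ card (hom_edges n d j l m) /
      ?W j l m ^ card {k. hom_monomial n d k j l m})"
  proof (rule prod.cong[OF refl], safe)
    fix j l m assume box: "(j, l, m) \<in> Box"
    note mult = tangent_mult_eq[OF d, of j l m, symmetric]
    show "inverse (1 - torus_weight n N j l m) ^ tangent_mult n d j l m =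
       ?W j l m ^ card (hom_edges n d j l m) / ?W j l m ^ card {k. hom_monomial n d k j l m}"
    proof (cases "j = l \<and> m = 0")
      case True
      then show ?thesis using mult unfolding no_hom[OF True] by simp
    next
      case False
      then show ?thesis unfolding mult using W[OF box]
        by (auto simp: weight_factor_def power_add field_simps)
    qed
  qed
  also have "\<dots> = (\<Prod>(j, l, m)\<in>Box. \<Prod>k=1..n-1.
      (if k \<in> hom_edges n d j l m then ?W j l m else 1) /
      (if hom_monomial n d k j l m then ?W j l m else 1))"
  proof (rule prod.cong[OF refl], safe)
    fix j l m
    have "{k. k \<in> hom_edges n d j l m} \<subseteq> {1..n-1}" by (auto simp: hom_edges_def)
    then have "?W j l m ^ card (hom_edges n d j l m) =
        (\<Prod>k=1..n-1. if k \<in> hom_edges n d j l m then ?W j l m else 1)"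
      using power_card_eq_prod[of "{1..n-1}" "\<lambda>k. k \<in> hom_edges n d j l m" "?W j l m"] by simp
    moreover have "?W j l m ^ card {k. hom_monomial n d k j l m} =
        (\<Prod>k=1..n-1. if hom_monomial n d k j l m then ?W j l m else 1)"
      by (rule power_card_eq_prod) (auto simp: hom_monomial_def)
    ultimately show "?W j l m ^ card (hom_edges n d j l m) /
        ?W j l m ^ card {k. hom_monomial n d k j l m} = (\<Prod>k=1..n-1.
      (if k \<in> hom_edges n d j l m then ?W j l m else 1) /
      (if hom_monomial n d k j l m then ?W j l m else 1))"
      by (simp add: prod_dividef)
  qed
  also have "\<dots> = (\<Prod>k=1..n-1. \<Prod>(j, l, m)\<in>Box.
      (if k \<in> hom_edges n d j l m then ?W j l m else 1) /
      (if hom_monomial n d k j l m then ?W j l m else 1))"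
    unfolding case_prod_beta by (rule prod.swap)
  also have "\<dots> = (\<Prod>k=1..n-1. edge_prod n N d k / hom_prod n N d k)"
  proof (rule prod.cong[OF refl])
    fix k assume k: "k \<in> {1..n-1}"
    then have kn: "1 \<le> k" "k \<le> n - 1" "k \<le> n" "k + 1 \<le> n" by auto
    let ?a = "\<lambda>j l. if l \<le> k then weight_prod n N j l (int (d k l) - int (d k j)) else 1"
    let ?b = "\<lambda>j l. if l \<le> k + 1 then weight_prod n N j l (int (d (k + 1) l) - int (d k j)) else 1"
    have "(\<Prod>(j, l, m)\<in>Box. (if k \<in> hom_edges n d j l m then ?W j l m else 1) /
        (if hom_monomial n d k j l m then ?W j l m else 1)) =
      (\<Prod>j=1..n. \<Prod>l=1..n. (\<Prod>m\<in>M. if k \<in> hom_edges n d j l m then ?W j l m else 1) /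
        (\<Prod>m\<in>M. if hom_monomial n d k j l m then ?W j l m else 1))"
      unfolding Box_def prod_dividef[symmetric] prod.cartesian_product ..
    also have "\<dots> = (\<Prod>j=1..n. \<Prod>l=1..n. if j \<le> k then ?b j l / ?a j l else 1)"
    proof (intro prod.cong refl)
      fix j l assume jl: "j \<in> {1..n}" "l \<in> {1..n}"
      let ?x = "\<Prod>m\<in>M. if hom_monomial n d k j l m then ?W j l m else 1"
      let ?y = "\<Prod>m\<in>M. if k \<in> hom_edges n d j l m then ?W j l m else 1"
      show "?y / ?x = (if j \<le> k then ?b j l / ?a j l else 1)"
      proof (cases "j \<le> k")
        case True
        have "?x / ?y = ?a j l / ?b j l"
          using jl True kn K R
          by (intro hom_weights_quotient[OF d \<open>N > 0\<close>] \<open>finite M\<close>) (auto simp: Box_def)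
        then have "inverse (?x / ?y) = inverse (?a j l / ?b j l)" by (rule arg_cong)
        then show ?thesis unfolding inverse_divide using True by simp
      next
        case False
        then show ?thesis by (simp add: hom_monomial_def hom_edges_def)
      qed
    qed
    also have "\<dots> = (\<Prod>j=1..n. if j \<le> k then \<Prod>l=1..n. ?b j l / ?a j l else 1)"
      by (intro prod.cong) auto
    also have "\<dots> = (\<Prod>j=1..k. \<Prod>l=1..n. ?b j l / ?a j l)"
      by (rule prod_extend_by_one[OF \<open>k \<le> n\<close>])
    also have "\<dots> = edge_prod n N d k / hom_prod n N d k"
      unfolding prod_dividef prod_extend_by_one[OF \<open>k \<le> n\<close>] prod_extend_by_one[OF \<open>k + 1 \<le> n\<close>]
        hom_prod_def edge_prod_def ..
    finally show "(\<Prod>(j, l, m)\<in>Box. (if k \<in> hom_edges n d j l m then ?W j l m else 1) /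
        (if hom_monomial n d k j l m then ?W j l m else 1)) = edge_prod n N d k / hom_prod n N d k" .
  qed
  finally show ?thesis by (simp add: prod_dividef)
qed


subsection \<open>Adding a box\<close>

lemma ss_neq_0 [simp]: "ss n N d i j \<noteq> 0"
  by (simp add: ss_def)

lemma ss_quotient: "ss n N d a l / ss n N d b j = torus_weight n N j l (int (d a l) - int (d b j))"
proof -
  have "vv N powi (- 2 * (int (d a l) - int (d b j))) =
      vv N powi (- 2 * int (d a l)) / vv N powi (- 2 * int (d b j))"
    by (subst power_int_diff[symmetric]) (simp_all add: algebra_simps)
  then show ?thesis by (simp add: ss_def torus_weight_def)
qed

text \<open>In the excluded case the left side is 0, whereas \<open>weight_factor\<close> is 1 by
  convention.\<close>

lemma one_minus_ss_quotient:
  assumes "\<not> (j = l \<and> int (d a l) - int (d b j) = 0)"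
  shows "1 - ss n N d a l / ss n N d b j = weight_factor n N j l (int (d a l) - int (d b j))"
  using assms unfolding ss_quotient weight_factor_def by (simp only: if_False)

lemma add_box_apply: "add_box d i p k j = d k j + (if k = i \<and> j = p then 1 else 0)"
  by (simp add: add_box_def)

lemma deg_add_box:
  assumes "p \<in> {1..i}"
  shows "deg (add_box d i p) k = deg d k + (if k = i then 1 else 0)"
  using assms unfolding deg_def add_box_apply by (cases "k = i") (simp_all add: sum.distrib)

text \<open>The only inequality that the new box can violate is the one between rows
  \<open>i - 1\<close> and \<open>i\<close> in column \<open>p\<close>; for \<open>p = i\<close>
  there is no entry above.\<close>

lemma add_box_in_fixed_points_iff:
  assumes d: "d \<in> fixed_points n" and i: "i \<in> {1..n-1}" and p: "p \<in> {1..i}"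
  shows "add_box d i p \<in> fixed_points n \<longleftrightarrow> p = i \<or> d i p < d (i - 1) p"
proof
  assume d': "add_box d i p \<in> fixed_points n"
  show "p = i \<or> d i p < d (i - 1) p"
  proof (cases "p = i")
    case False
    then have "add_box d i p i p \<le> add_box d i p (i - 1) p"
      using p by (intro fixed_points_antimono[OF d']) auto
    moreover have "i - 1 \<noteq> i" using i by auto
    ultimately show ?thesis by (simp add: add_box_apply)
  qed simp
next
  assume *: "p = i \<or> d i p < d (i - 1) p"
  have "add_box d i p a j \<le> add_box d i p k j" if "1 \<le> j" "j \<le> k" "k \<le> a" "a \<le> n - 1" for a k j
  proof (cases "a = i \<and> j = p \<and> k \<noteq> i")
    case True
    then have "d (i - 1) p \<le> d k p" using that by (intro fixed_points_antimono[OF d]) auto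
    then show ?thesis using True * that by (auto simp: add_box_apply)
  next
    case False
    then show ?thesis using fixed_points_antimono[OF d that(1-3)] by (auto simp: add_box_apply)
  qed
  moreover have "add_box d i p a j = 0" if "\<not> (1 \<le> j \<and> j \<le> a \<and> a \<le> n - 1)" for a j
    using d that i p by (auto simp: add_box_apply fixed_points_def)
  ultimately show "add_box d i p \<in> fixed_points n" by (simp add: fixed_points_def)
qed

section \<open>Change of the localization coefficient under adding a box\<close>

lemma prod_if_neq:
  fixes A :: "nat set"
  assumes "finite A"
  shows "(\<Prod>j\<in>A. if j \<noteq> p then g j else (1::'a::comm_monoid_mult)) = (\<Prod>j\<in>A - {p}. g j)"
proof -
  have "(\<Prod>j\<in>A - {p}. g j) = (\<Prod>j\<in>A - {p}. if j \<noteq> p then g j else 1)" by (rule prod.cong) auto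
  also have "\<dots> = (\<Prod>j\<in>A. if j \<noteq> p then g j else 1)"
    using assms by (intro prod.mono_neutral_left) auto
  finally show ?thesis by simp
qed

text \<open>Only pairs with exactly one of \<open>j\<close>, \<open>l\<close> equal to
  \<open>p\<close> change: the argument of \<open>weight_prod\<close> rises by 1 if
  \<open>l = p\<close>, gaining a factor, and drops by 1 if \<open>j = p\<close>, losing the factor
  at the lowered argument.\<close>

lemma hom_prod_add_box:
  assumes "N > 0" "p \<in> {1..i}" "i \<le> n"
  shows "hom_prod n N (add_box d i p) i = hom_prod n N d i *
    (\<Prod>j\<in>{1..i} - {p}. weight_factor n N j p (int (d i p) - int (d i j))) /
    (\<Prod>l\<in>{1..i} - {p}. weight_factor n N p l (int (d i l) - int (d i p) - 1))"
proof -
  let ?W = "weight_factor n N"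
  let ?g = "\<lambda>j. ?W j p (int (d i p) - int (d i j))"
  let ?h = "\<lambda>l. ?W p l (int (d i l) - int (d i p) - 1)"
  have "hom_prod n N (add_box d i p) i = (\<Prod>j=1..i. \<Prod>l=1..i.
      weight_prod n N j l (int (d i l) - int (d i j)) * (if l = p then if j \<noteq> p then ?g j else 1 else 1) /
      (if j = p then if l \<noteq> p then ?h l else 1 else 1))"
    unfolding hom_prod_def
  proof (intro prod.cong refl)
    fix j l assume jl: "j \<in> {1..i}" "l \<in> {1..i}"
    have W: "?W j l m \<noteq> 0" for m using weight_factor_neq_0[of N j n l m] assms jl by auto
    consider "l = p" "j \<noteq> p" | "l \<noteq> p" "j = p" | "l = p \<longleftrightarrow> j = p" by blast
    then show "weight_prod n N j l (int (add_box d i p i l) - int (add_box d i p i j)) =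
      weight_prod n N j l (int (d i l) - int (d i j)) * (if l = p then if j \<noteq> p then ?g j else 1 else 1) /
      (if j = p then if l \<noteq> p then ?h l else 1 else 1)"
    proof cases
      case 1
      then show ?thesis
        using signed_prod_add_1[of "?W j l" "int (d i p) - int (d i j)", OF W]
        by (simp add: add_box_apply algebra_simps)
    next
      case 2
      then show ?thesis
        using signed_prod_add_1[of "?W j l" "int (d i l) - int (d i p) - 1", OF W] W
        by (simp add: add_box_apply algebra_simps)
    next
      case 3
      then show ?thesis by (auto simp: add_box_apply)
    qed
  qed
  also have "\<dots> = hom_prod n N d i *
      (\<Prod>j=1..i. \<Prod>l=1..i. if l = p then if j \<noteq> p then ?g j else 1 else 1) /
      (\<Prod>j=1..i. \<Prod>l=1..i. if j = p then if l \<noteq> p then ?h l else 1 else 1)"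
    by (simp add: prod.distrib prod_dividef hom_prod_def)
  also have "(\<Prod>j=1..i. \<Prod>l=1..i. if l = p then if j \<noteq> p then ?g j else 1 else 1) =
      (\<Prod>j\<in>{1..i} - {p}. ?g j)"
    using assms(2) by (simp add: prod_if_neq)
  also have "(\<Prod>j=1..i. \<Prod>l=1..i. if j = p then if l \<noteq> p then ?h l else 1 else 1) =
      (\<Prod>l\<in>{1..i} - {p}. ?h l)"
    using assms(2) by (subst prod.swap) (simp add: prod_if_neq)
  finally show ?thesis .
qed

text \<open>Row \<open>i\<close> enters here as the source of homomorphisms, so exactly the
  arguments with \<open>j = p\<close> drop by 1.\<close>

lemma edge_prod_add_box_same:
  assumes "N > 0" "p \<in> {1..i}" "i + 1 \<le> n"
  shows "edge_prod n N (add_box d i p) i = edge_prod n N d i /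
    (\<Prod>l=1..i+1. weight_factor n N p l (int (d (i + 1) l) - int (d i p) - 1))"
proof -
  let ?W = "weight_factor n N"
  let ?h = "\<lambda>l. ?W p l (int (d (i + 1) l) - int (d i p) - 1)"
  have "edge_prod n N (add_box d i p) i = (\<Prod>j=1..i. \<Prod>l=1..i+1.
      weight_prod n N j l (int (d (i + 1) l) - int (d i j)) / (if j = p then ?h l else 1))"
    unfolding edge_prod_def
  proof (intro prod.cong refl)
    fix j l assume jl: "j \<in> {1..i}" "l \<in> {1..i+1}"
    have W: "?W j l m \<noteq> 0" for m using weight_factor_neq_0[of N j n l m] assms jl by auto
    show "weight_prod n N j l (int (add_box d i p (i + 1) l) - int (add_box d i p i j)) =
      weight_prod n N j l (int (d (i + 1) l) - int (d i j)) / (if j = p then ?h l else 1)"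
      using signed_prod_add_1[of "?W j l" "int (d (i + 1) l) - int (d i p) - 1", OF W] W
      by (cases "j = p") (simp_all add: add_box_apply field_simps)
  qed
  also have "\<dots> = edge_prod n N d i / (\<Prod>j=1..i. \<Prod>l=1..i+1. if j = p then ?h l else 1)"
    unfolding prod_dividef edge_prod_def ..
  also have "(\<Prod>j=1..i. \<Prod>l=1..i+1. if j = p then ?h l else 1) = (\<Prod>l=1..i+1. ?h l)"
    using assms(2) by (subst prod.swap) simp
  finally show ?thesis .
qed

text \<open>Row \<open>i\<close> enters here through the target, so exactly the arguments with
  \<open>l = p\<close> rise by 1.\<close>

lemma edge_prod_add_box_pred:
  assumes "N > 0" "p \<in> {1..i}" "i \<le> n"
  shows "edge_prod n N (add_box d i p) (i - 1) = edge_prod n N d (i - 1) *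
    (\<Prod>j=1..i-1. weight_factor n N j p (int (d i p) - int (d (i - 1) j)))"
proof -
  let ?W = "weight_factor n N"
  let ?g = "\<lambda>j. ?W j p (int (d i p) - int (d (i - 1) j))"
  have i: "i - 1 + 1 = i" "i - 1 \<noteq> i" using assms(2) by auto
  have "edge_prod n N (add_box d i p) (i - 1) = (\<Prod>j=1..i-1. \<Prod>l=1..i.
      weight_prod n N j l (int (d i l) - int (d (i - 1) j)) * (if l = p then ?g j else 1))"
    unfolding edge_prod_def i
  proof (intro prod.cong refl)
    fix j l assume jl: "j \<in> {1..i-1}" "l \<in> {1..i}"
    then have "j \<in> {1..n}" "l \<in> {1..n}" using \<open>i \<le> n\<close> by auto
    then have W: "?W j l m \<noteq> 0" for m using weight_factor_neq_0 \<open>N > 0\<close> by blast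
    show "weight_prod n N j l (int (add_box d i p i l) - int (add_box d i p (i - 1) j)) =
      weight_prod n N j l (int (d i l) - int (d (i - 1) j)) * (if l = p then ?g j else 1)"
      using signed_prod_add_1[of "?W j l" "int (d i p) - int (d (i - 1) j)", OF W] i
      by (cases "l = p") (simp_all add: add_box_apply algebra_simps)
  qed
  also have "\<dots> = edge_prod n N d (i - 1) * (\<Prod>j=1..i-1. \<Prod>l=1..i. if l = p then ?g j else 1)"
    unfolding prod.distrib edge_prod_def i ..
  also have "(\<Prod>j=1..i-1. \<Prod>l=1..i. if l = p then ?g j else 1) = (\<Prod>j=1..i-1. ?g j)"
    using assms(2) by simp
  finally show ?thesis .
qed

lemma hom_prod_add_box_other: "k \<noteq> i \<Longrightarrow> hom_prod n N (add_box d i p) k = hom_prod n N d k"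
  by (simp add: hom_prod_def add_box_apply)

lemma edge_prod_add_box_other:
  "k \<noteq> i \<Longrightarrow> k + 1 \<noteq> i \<Longrightarrow> edge_prod n N (add_box d i p) k = edge_prod n N d k"
  by (simp add: edge_prod_def add_box_apply)

text \<open>The added factor at \<open>k = 0\<close> is an empty product; with it the change at
  \<open>k = i - 1\<close> needs no exception for \<open>i = 1\<close>.\<close>

lemma fp_coeff_eq_from_0:
  assumes "d \<in> fixed_points n" and "N > 0"
  shows "inverse (fp_coeff n N d) = (\<Prod>k=0..n-1. hom_prod n N d k / edge_prod n N d k)"
proof -
  have "{0..n-1} = insert 0 {1..n-1}" by auto
  then show ?thesis
    unfolding fp_coeff_eq[OF assms] by (simp add: hom_prod_def edge_prod_def)
qed

text \<open>The relation between \<open>p_* q^*\<close> and \<open>q_* p^*\<close>: the products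
  \<open>?P2\<close> and \<open>?P3\<close> in the ratio of localization coefficients cancel those
  in \<open>pq_coeff\<close>, leaving \<open>?P1\<close> and \<open>?P4\<close>, which make up the
  coefficient of \<open>q_* p^*\<close> at \<open>d\<close>.\<close>

lemma fp_coeff_pq_coeff:
  assumes d: "d \<in> fixed_points n" and "N > 0" and i: "i \<in> {1..n-1}" and p: "p \<in> {1..i}"
    and d': "add_box d i p \<in> fixed_points n"
  shows "pq_coeff n N i (add_box d i p) p * fp_coeff n N (add_box d i p) =
    fp_coeff n N d * inverse (1 - vv N ^ 2) *
    ((\<Prod>j\<in>{1..i} - {p}. inverse (1 - ss n N d i p / ss n N d i j)) *
     (\<Prod>j=1..i-1. 1 - ss n N d i p / ss n N d (i - 1) j))"
proof -
  let ?d' = "add_box d i p" and ?W = "weight_factor n N"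
  let ?P1 = "\<Prod>j\<in>{1..i} - {p}. ?W j p (int (d i p) - int (d i j))"
  let ?P2 = "\<Prod>l\<in>{1..i} - {p}. ?W p l (int (d i l) - int (d i p) - 1)"
  let ?P3 = "\<Prod>l=1..i+1. ?W p l (int (d (i + 1) l) - int (d i p) - 1)"
  let ?P4 = "\<Prod>j=1..i-1. ?W j p (int (d i p) - int (d (i - 1) j))"
  have ineq: "i \<le> n" "i + 1 \<le> n" "i - 1 \<noteq> i" "i \<le> n - 1" "i - 1 \<le> n - 1" using i by auto
  have W: "?W j l m \<noteq> 0" if "1 \<le> j" "j \<le> n" "1 \<le> l" "l \<le> n" for j l m
    using weight_factor_neq_0[OF \<open>N > 0\<close>] that by simp
  have nz: "?P1 \<noteq> 0" "?P2 \<noteq> 0" "?P3 \<noteq> 0" "?P4 \<noteq> 0"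
    using p ineq by (auto simp: W)
  have quot: "hom_prod n N ?d' k / edge_prod n N ?d' k = hom_prod n N d k / edge_prod n N d k *
      (if k = i then ?P1 / ?P2 * ?P3 else 1) * (if k = i - 1 then inverse ?P4 else 1)" for k
  proof -
    consider "k = i" | "k = i - 1" "k \<noteq> i" | "k \<noteq> i" "k \<noteq> i - 1" by blast
    then show ?thesis
    proof cases
      case 1
      then show ?thesis using ineq
        unfolding 1 hom_prod_add_box[OF \<open>N > 0\<close> p ineq(1)] edge_prod_add_box_same[OF \<open>N > 0\<close> p ineq(2)]
        by (simp add: mult_ac)
    next
      case 2
      then show ?thesis
        unfolding 2(1) hom_prod_add_box_other[OF ineq(3)] edge_prod_add_box_pred[OF \<open>N > 0\<close> p ineq(1)]
        by (simp add: divide_inverse)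
    next
      case 3
      then have "k + 1 \<noteq> i" by auto
      then show ?thesis using 3 by (simp add: hom_prod_add_box_other edge_prod_add_box_other)
    qed
  qed
  have "inverse (fp_coeff n N ?d') = inverse (fp_coeff n N d) * (?P1 / ?P2 * ?P3) * inverse ?P4"
    unfolding fp_coeff_eq_from_0[OF d' \<open>N > 0\<close>] fp_coeff_eq_from_0[OF d \<open>N > 0\<close>] quot prod.distrib
    using ineq by simp
  then have "inverse (inverse (fp_coeff n N ?d')) =
      inverse (inverse (fp_coeff n N d) * (?P1 / ?P2 * ?P3) * inverse ?P4)" by (rule arg_cong)
  then have fp: "fp_coeff n N ?d' = fp_coeff n N d * ?P2 * ?P4 / (?P1 * ?P3)"
    by (simp add: field_simps)
  \<comment> \<open>\<open>below\<close> and \<open>above\<close> keep the factors of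
    \<open>?P3\<close> and \<open>?P4\<close> with equal column indices away from the exceptional
    value of \<open>weight_factor\<close>; the second inequality expresses that the box can be
    added.\<close>
  have below: "d (i + 1) p \<le> d i p" using fixed_points_antimono[OF d] p by simp
  have above: "d i p < d (i - 1) p" if "p \<le> i - 1"
    using add_box_in_fixed_points_iff[OF d i p] d' that p by auto
  have P1: "(\<Prod>j\<in>{1..i} - {p}. inverse (1 - ss n N d i p / ss n N d i j)) = inverse ?P1"
    by (simp add: one_minus_ss_quotient flip: prod_inversef)
  have P2: "(\<Prod>k\<in>{1..i} - {p}. inverse (1 - ss n N ?d' i k / ss n N ?d' i p)) = inverse ?P2"
    by (simp add: one_minus_ss_quotient add_box_apply algebra_simps flip: prod_inversef)
  have P3: "(\<Prod>k=1..i+1. 1 - ss n N ?d' (i + 1) k / ss n N ?d' i p) = ?P3"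
  proof (rule prod.cong[OF refl])
    fix k
    have "\<not> (p = k \<and> int (?d' (i + 1) k) - int (?d' i p) = 0)"
      using below by (auto simp: add_box_apply)
    then show "1 - ss n N ?d' (i + 1) k / ss n N ?d' i p = ?W p k (int (d (i + 1) k) - int (d i p) - 1)"
      by (subst one_minus_ss_quotient) (simp_all add: add_box_apply algebra_simps)
  qed
  have P4: "(\<Prod>j=1..i-1. 1 - ss n N d i p / ss n N d (i - 1) j) = ?P4"
    using above by (intro prod.cong refl one_minus_ss_quotient) auto
  have "s * inverse b * c * (f * b * e / (a * c)) = f * s * (inverse a * e)"
    if "b \<noteq> 0" "c \<noteq> 0" for a b c e f s :: scalar
    using that by (cases "a = 0") (simp_all add: field_simps)
  from this[OF nz(2,3)] show ?thesis
    unfolding pq_coeff_def P1 P2 P3 P4 fp .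
qed


subsection \<open>Lagrange interpolation\<close>

text \<open>The polynomial \<open>P\<close> has degree below the number of nodes \<open>x j\<close>,
  so it equals its interpolant \<open>Q\<close>. At 0 the Lagrange basis polynomials become the
  products of \<open>inverse (1 - x j / x k)\<close>, and \<open>P\<close> takes the value
  1.\<close>

lemma lagrange_eval_0:
  fixes x y :: "nat \<Rightarrow> 'a::field"
  assumes "finite S" "finite U" "card U < card S" and inj: "inj_on x S" and x: "\<And>k. k \<in> S \<Longrightarrow> x k \<noteq> 0"
  shows "(\<Sum>j\<in>S. (\<Prod>k\<in>S - {j}. inverse (1 - x j / x k)) * (\<Prod>k\<in>U. 1 - x j / y k)) = 1"
proof -
  define P where "P = (\<Prod>k\<in>U. [:1, - inverse (y k):])"
  define Q where "Q = (\<Sum>j\<in>S. smult (poly P (x j))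
      (\<Prod>k\<in>S - {j}. smult (inverse (x j - x k)) [:- x k, 1:]))"
  have P: "poly P z = (\<Prod>k\<in>U. 1 - z / y k)" for z
    by (simp add: P_def poly_prod divide_inverse)
  have "degree P \<le> (\<Sum>k\<in>U. degree [:1, - inverse (y k):])"
    unfolding P_def using \<open>finite U\<close> by (rule degree_prod_sum_le[unfolded comp_def])
  also have "\<dots> \<le> (\<Sum>k\<in>U. 1)" by (intro sum_mono) auto
  finally have "degree P < card S" using assms(3) by simp
  have "degree (\<Prod>k\<in>S - {j}. smult (inverse (x j - x k)) [:- x k, 1:]) < card S" if "j \<in> S" for j
  proof -
    have "degree (\<Prod>k\<in>S - {j}. smult (inverse (x j - x k)) [:- x k, 1:]) \<le>
        (\<Sum>k\<in>S - {j}. degree (smult (inverse (x j - x k)) [:- x k, 1:]))"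
      using \<open>finite S\<close> by (intro degree_prod_sum_le[unfolded comp_def] finite_Diff)
    also have "\<dots> \<le> (\<Sum>k\<in>S - {j}. 1)" by (intro sum_mono) auto
    also have "\<dots> < card S" using card_Diff1_less[OF \<open>finite S\<close> that] by simp
    finally show ?thesis .
  qed
  then have "degree Q < card S" unfolding Q_def
    using assms(3) by (intro degree_sum_less) (auto intro: le_less_trans[OF degree_smult_le])
  have "poly Q (x i) = poly P (x i)" if i: "i \<in> S" for i
  proof -
    have "poly Q (x i) = (\<Sum>j\<in>S. poly P (x j) * (\<Prod>k\<in>S - {j}. inverse (x j - x k) * (x i - x k)))"
      by (simp add: Q_def poly_sum poly_prod algebra_simps)
    also have "\<dots> = (\<Sum>j\<in>S. if j = i then poly P (x i) else 0)"
    proof (rule sum.cong[OF refl])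
      fix j assume j: "j \<in> S"
      have "(\<Prod>k\<in>S - {j}. inverse (x j - x k) * (x i - x k)) = (if j = i then 1 else 0)"
      proof (cases "j = i")
        case True
        have "x i - x k \<noteq> 0" if "k \<in> S - {i}" for k using that i inj by (auto dest: inj_onD)
        then show ?thesis using True by (auto intro!: prod.neutral)
      next
        case False
        then show ?thesis using i \<open>finite S\<close> by (auto simp: prod_zero_iff)
      qed
      then show "poly P (x j) * (\<Prod>k\<in>S - {j}. inverse (x j - x k) * (x i - x k)) =
          (if j = i then poly P (x i) else 0)" by simp
    qed
    finally show ?thesis using i \<open>finite S\<close> by simp
  qed
  then have "Q = P"
    using \<open>degree P < card S\<close> \<open>degree Q < card S\<close> inj
    by (intro poly_eqI_degree[of "x ` S"]) (auto simp: card_image)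
  have "1 = poly Q 0" unfolding \<open>Q = P\<close> by (simp add: P)
  also have "\<dots> = (\<Sum>j\<in>S. poly P (x j) * (\<Prod>k\<in>S - {j}. inverse (x j - x k) * (- x k)))"
    by (simp add: Q_def poly_sum poly_prod)
  also have "\<dots> = (\<Sum>j\<in>S. (\<Prod>k\<in>S - {j}. inverse (1 - x j / x k)) * (\<Prod>k\<in>U. 1 - x j / y k))"
  proof (rule sum.cong[OF refl])
    fix j assume j: "j \<in> S"
    have "(\<Prod>k\<in>S - {j}. inverse (x j - x k) * (- x k)) = (\<Prod>k\<in>S - {j}. inverse (1 - x j / x k))"
    proof (rule prod.cong[OF refl])
      fix k assume k: "k \<in> S - {j}"
      then have "x k \<noteq> 0" "x j - x k \<noteq> 0" "x k - x j \<noteq> 0" using x j inj by (auto dest: inj_onD)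
      then show "inverse (x j - x k) * (- x k) = inverse (1 - x j / x k)"
        by (simp add: field_simps)
    qed
    then show "poly P (x j) * (\<Prod>k\<in>S - {j}. inverse (x j - x k) * (- x k)) =
        (\<Prod>k\<in>S - {j}. inverse (1 - x j / x k)) * (\<Prod>k\<in>U. 1 - x j / y k)"
      by (simp add: P mult.commute)
  qed
  finally show ?thesis by simp
qed

lemma lagrange_eval_infinity:
  fixes x y :: "nat \<Rightarrow> 'a::field"
  assumes fin: "finite S" "finite U" and card: "card S = card U + 1" and inj: "inj_on x S"
    and x: "\<And>k. k \<in> S \<Longrightarrow> x k \<noteq> 0" and y: "\<And>k. k \<in> U \<Longrightarrow> y k \<noteq> 0"
  shows "(\<Sum>j\<in>S. x j * ((\<Prod>k\<in>S - {j}. inverse (1 - x j / x k)) * (\<Prod>k\<in>U. 1 - x j / y k))) =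
    (\<Prod>k\<in>S. x k) / (\<Prod>k\<in>U. y k)"
  \<comment> \<open>The substitution \<open>x \<mapsto> x\<inverse>\<close>, \<open>y \<mapsto> y\<inverse>\<close> reduces this to evaluation at 0.\<close>
proof -
  let ?X = "\<Prod>k\<in>S. x k" and ?Y = "\<Prod>k\<in>U. y k"
  have XY: "?X \<noteq> 0" "?Y \<noteq> 0" using x y fin by auto
  have "1 = (\<Sum>j\<in>S. (\<Prod>k\<in>S - {j}. inverse (1 - inverse (x j) / inverse (x k))) *
      (\<Prod>k\<in>U. 1 - inverse (x j) / inverse (y k)))"
    using fin card inj x by (intro lagrange_eval_0[symmetric]) (auto simp: inj_on_def)
  also have "\<dots> = (\<Sum>j\<in>S. ?Y / ?X *
      (x j * ((\<Prod>k\<in>S - {j}. inverse (1 - x j / x k)) * (\<Prod>k\<in>U. 1 - x j / y k))))"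
  proof (rule sum.cong[OF refl])
    fix j assume j: "j \<in> S"
    have xj: "x j \<noteq> 0" using x j by simp
    have "(\<Prod>k\<in>S - {j}. inverse (1 - inverse (x j) / inverse (x k))) =
        (\<Prod>k\<in>S - {j}. (- x j) / x k * inverse (1 - x j / x k))"
    proof (rule prod.cong[OF refl])
      fix k assume k: "k \<in> S - {j}"
      then have "x k \<noteq> 0" "x j - x k \<noteq> 0" "x k - x j \<noteq> 0" using x j inj by (auto dest: inj_onD)
      then show "inverse (1 - inverse (x j) / inverse (x k)) = (- x j) / x k * inverse (1 - x j / x k)"
        using xj by (simp add: field_simps)
    qed
    \<comment> \<open>Since \<open>S - {j}\<close> and \<open>U\<close> have the same size, this
      power of \<open>- x j\<close> cancels against the one from the product over
      \<open>U\<close>.\<close>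
    also have "\<dots> = (- x j) ^ card U / (\<Prod>k\<in>S - {j}. x k) * (\<Prod>k\<in>S - {j}. inverse (1 - x j / x k))"
      using card j fin by (simp only: prod.distrib prod_dividef prod_constant card_Diff_singleton) simp
    also have "(\<Prod>k\<in>S - {j}. x k) = ?X / x j"
      using prod.remove[OF fin(1) j, of x] xj by simp
    finally have 1: "(\<Prod>k\<in>S - {j}. inverse (1 - inverse (x j) / inverse (x k))) =
        (- x j) ^ card U / (?X / x j) * (\<Prod>k\<in>S - {j}. inverse (1 - x j / x k))" .
    have "(\<Prod>k\<in>U. 1 - inverse (x j) / inverse (y k)) = (\<Prod>k\<in>U. y k / (- x j) * (1 - x j / y k))"
      using y xj by (intro prod.cong refl) (auto simp: field_simps)
    also have "\<dots> = ?Y / (- x j) ^ card U * (\<Prod>k\<in>U. 1 - x j / y k)"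
      by (simp only: prod.distrib prod_dividef prod_constant)
    finally have 2: "(\<Prod>k\<in>U. 1 - inverse (x j) / inverse (y k)) =
        ?Y / (- x j) ^ card U * (\<Prod>k\<in>U. 1 - x j / y k)" .
    have z: "(- x j) ^ card U \<noteq> 0" using xj by simp
    have "a / (b / c) * e * (f / a * g) = f / b * (c * (e * g))" if "a \<noteq> 0" for a b c e f g :: 'a
      using that by simp
    from this[OF z] show "(\<Prod>k\<in>S - {j}. inverse (1 - inverse (x j) / inverse (x k))) *
        (\<Prod>k\<in>U. 1 - inverse (x j) / inverse (y k)) = ?Y / ?X *
        (x j * ((\<Prod>k\<in>S - {j}. inverse (1 - x j / x k)) * (\<Prod>k\<in>U. 1 - x j / y k)))"
      unfolding 1 2 .
  qed
  finally show ?thesis using XY unfolding sum_distrib_left[symmetric] by (simp add: field_simps)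
qed


subsection \<open>The ground field\<close>

text \<open>The Laurent polynomials in the first \<open>n\<close> variables. Closure of their
  fractions under field operations shows that the localization coefficients lie in the ground
  field.\<close>

definition ground_ring :: "nat \<Rightarrow> laurent set" where
  "ground_ring n = {p. \<forall>e \<in> Poly_Mapping.keys p. Poly_Mapping.keys e \<subseteq> {..<n}}"

lemma ground_field_altdef: "ground_field n = {Fract p q | p q. q \<noteq> 0 \<and> p \<in> ground_ring n \<and> q \<in> ground_ring n}"
  unfolding ground_field_def ground_ring_def by blast

lemma ground_ring_one: "1 \<in> ground_ring n"
  by (simp add: ground_ring_def)

lemma ground_ring_uminus: "p \<in> ground_ring n \<Longrightarrow> - p \<in> ground_ring n"
  by (simp add: ground_ring_def)

lemma ground_ring_add: "p \<in> ground_ring n \<Longrightarrow> q \<in> ground_ring n \<Longrightarrow> p + q \<in> ground_ring n"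
  unfolding ground_ring_def using keys_add[of p q] by blast

lemma ground_ring_mult:
  assumes "p \<in> ground_ring n" "q \<in> ground_ring n"
  shows "p * q \<in> ground_ring n"
  unfolding ground_ring_def
proof (safe del: subsetI)
  fix e assume "e \<in> Poly_Mapping.keys (p * q)"
  then obtain a b where "a \<in> Poly_Mapping.keys p" "b \<in> Poly_Mapping.keys q" "e = a + b"
    using keys_mult[of p q] by blast
  then show "Poly_Mapping.keys e \<subseteq> {..<n}"
    using assms keys_add[of a b] unfolding ground_ring_def by blast
qed

lemma ground_field_one: "1 \<in> ground_field n"
  unfolding ground_field_altdef One_fract_def using ground_ring_one by fastforce

lemma ground_field_diff:
  assumes "x \<in> ground_field n" "y \<in> ground_field n"
  shows "x - y \<in> ground_field n"
proof -
  obtain p q r s where "x = Fract p q" "y = Fract r s" "q \<noteq> 0" "s \<noteq> 0" and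
    *: "p \<in> ground_ring n" "q \<in> ground_ring n" "r \<in> ground_ring n" "s \<in> ground_ring n"
    using assms unfolding ground_field_altdef by blast
  then have "x - y = Fract (p * s + - (r * q)) (q * s)" "q * s \<noteq> 0" by auto
  then show ?thesis using *
    unfolding ground_field_altdef by (blast intro: ground_ring_mult ground_ring_add ground_ring_uminus)
qed

lemma ground_field_mult:
  assumes "x \<in> ground_field n" "y \<in> ground_field n"
  shows "x * y \<in> ground_field n"
proof -
  obtain p q r s where "x = Fract p q" "y = Fract r s" "q \<noteq> 0" "s \<noteq> 0" and
    *: "p \<in> ground_ring n" "q \<in> ground_ring n" "r \<in> ground_ring n" "s \<in> ground_ring n"
    using assms unfolding ground_field_altdef by blast
  then have "x * y = Fract (p * r) (q * s)" "q * s \<noteq> 0" by auto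
  then show ?thesis using * unfolding ground_field_altdef by (blast intro: ground_ring_mult)
qed

lemma ground_field_inverse:
  assumes "x \<in> ground_field n"
  shows "inverse x \<in> ground_field n"
proof (cases "x = 0")
  case False
  obtain p q where "x = Fract p q" "q \<noteq> 0" and *: "p \<in> ground_ring n" "q \<in> ground_ring n"
    using assms unfolding ground_field_altdef by blast
  moreover from this False have "p \<noteq> 0" by (auto simp: Zero_fract_def eq_fract)
  ultimately show ?thesis unfolding ground_field_altdef by auto
\<comment> \<open>For \<open>x = 0\<close> the convention \<open>inverse 0 = 0\<close>
  applies.\<close>
qed (use assms in simp)

lemma ground_field_prod: "(\<And>x. x \<in> A \<Longrightarrow> f x \<in> ground_field n) \<Longrightarrow> prod f A \<in> ground_field n"
  by (induction A rule: infinite_finite_induct) (auto intro: ground_field_one ground_field_mult)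

lemma ground_field_power: "x \<in> ground_field n \<Longrightarrow> x ^ k \<in> ground_field n"
  by (induction k) (auto intro: ground_field_one ground_field_mult)

lemma ground_field_power_int: "x \<in> ground_field n \<Longrightarrow> x powi k \<in> ground_field n"
  by (simp add: power_int_def ground_field_power ground_field_inverse)

lemma indet_in_ground_field:
  assumes "i < n"
  shows "indet i \<in> ground_field n"
proof -
  have "Poly_Mapping.single (Poly_Mapping.single i 1) 1 \<in> ground_ring n"
    using assms by (auto simp: ground_ring_def)
  then show ?thesis
    unfolding indet_def ground_field_altdef using ground_ring_one by fastforce
qed

lemma torus_weight_in_ground_field:
  assumes "n \<ge> 1"
  shows "torus_weight n N j l m \<in> ground_field n"
proof -
  have "tt n k \<in> ground_field n" for k
    by (auto simp: tt_def intro!: indet_in_ground_field ground_field_inverse ground_field_prod)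
  moreover have "vv N \<in> ground_field n"
    unfolding vv_def using assms by (intro ground_field_power indet_in_ground_field) simp
  ultimately show ?thesis unfolding torus_weight_def divide_inverse
    by (intro ground_field_mult ground_field_inverse ground_field_power ground_field_power_int)
qed


subsection \<open>The Whittaker vector\<close>

lemma whittaker_apply: "whittaker n N d = (if d \<in> fixed_points n then fp_coeff n N d else 0)"
  by (simp add: whittaker_def structure_sheaf_def)

lemma whittaker_in_M_hat:
  assumes "n \<ge> 1"
  shows "whittaker n N \<in> M_hat n"
proof -
  have "fp_coeff n N d \<in> ground_field n" for d
    unfolding fp_coeff_def case_prod_beta using torus_weight_in_ground_field[OF assms]
    by (intro ground_field_prod ground_field_power ground_field_inverse ground_field_diff ground_field_one)
  then show ?thesis by (simp add: M_hat_def whittaker_apply)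
qed

text \<open>The operators \<open>L\<close> are diagonal, so a general diagonal factor
  \<open>c\<close> treats both identities at once. The sum runs over all \<open>p \<le> i\<close>,
  as interpolation requires, and not only over addable boxes.\<close>

lemma e_op_diagonal_whittaker:
  assumes d: "d \<in> fixed_points n" and "N > 0" and i: "i \<in> {1..n-1}"
  shows "e_op n N i r (\<lambda>d. c d * whittaker n N d) d =
    fp_coeff n N d * inverse (1 - vv N ^ 2) *
    (\<Sum>p=1..i. inverse (tt n (i + 1)) *
        vv N powi (int (deg d (i + 1)) - int (deg d i) - int i) *
        (vv N ^ i * ss n N d i p) powi r * c (add_box d i p) *
       ((\<Prod>j\<in>{1..i} - {p}. inverse (1 - ss n N d i p / ss n N d i j)) *
        (\<Prod>j=1..i-1. 1 - ss n N d i p / ss n N d (i - 1) j)))"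
    (is "_ = _ * (\<Sum>p=1..i. ?u p * ?Q p)")
proof -
  have "e_op n N i r (\<lambda>d. c d * whittaker n N d) d =
      (\<Sum>p \<in> {p \<in> {1..i}. add_box d i p \<in> fixed_points n}.
        fp_coeff n N d * inverse (1 - vv N ^ 2) * (?u p * ?Q p))"
    unfolding e_op_def if_P[OF d]
  proof (rule sum.cong[OF refl])
    fix p assume "p \<in> {p \<in> {1..i}. add_box d i p \<in> fixed_points n}"
    then have p: "p \<in> {1..i}" and d': "add_box d i p \<in> fixed_points n" by auto
    \<comment> \<open>Adding the box multiplies \<open>s_ip\<close> by \<open>v^(-2)\<close>, which
      turns the prefactor \<open>v^(i+2)\<close> into \<open>v^i\<close>.\<close>
    have "vv N powi (- 2 * int (d i p + 1)) * vv N ^ 2 = vv N powi (- 2 * int (d i p))"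
      using power_int_add[of "vv N" "- 2 * int (d i p + 1)" 2] by simp
    moreover have "vv N ^ (i + 2) * ss n N (add_box d i p) i p =
        vv N ^ i * (tt n p ^ 2 * (vv N powi (- 2 * int (d i p + 1)) * vv N ^ 2))"
      by (simp only: ss_def add_box_apply power_add simp_thms if_True mult_ac)
    ultimately have ss: "vv N ^ (i + 2) * ss n N (add_box d i p) i p = vv N ^ i * ss n N d i p"
      by (simp only: ss_def)
    \<comment> \<open>The raised degree in row \<open>i\<close> absorbs the summand 1.\<close>
    have deg: "int (deg (add_box d i p) (i + 1)) - int (deg (add_box d i p) i) + 1 - int i =
        int (deg d (i + 1)) - int (deg d i) - int i"
      using deg_add_box[OF p] by simp
    show "e_coeff n N i r (add_box d i p) p * (c (add_box d i p) * whittaker n N (add_box d i p)) =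
        fp_coeff n N d * inverse (1 - vv N ^ 2) * (?u p * ?Q p)"
      unfolding e_coeff_def ss deg whittaker_apply if_P[OF d']
      using fp_coeff_pq_coeff[OF d \<open>N > 0\<close> i p d'] by (simp add: mult_ac)
  qed
  \<comment> \<open>If \<open>d + \<delta>\<^sub>i\<^sub>p\<close> is not a fixed point then \<open>s\<^sub>i\<^sub>p = s\<^sub>i\<^sub>-\<^sub>1\<^sub>,\<^sub>p\<close>, so its term vanishes.\<close>
  also have "\<dots> = (\<Sum>p=1..i. fp_coeff n N d * inverse (1 - vv N ^ 2) * (?u p * ?Q p))"
  proof (rule sum.mono_neutral_left)
    show "\<forall>p\<in>{1..i} - {p \<in> {1..i}. add_box d i p \<in> fixed_points n}.
        fp_coeff n N d * inverse (1 - vv N ^ 2) * (?u p * ?Q p) = 0"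
    proof
      fix p assume "p \<in> {1..i} - {p \<in> {1..i}. add_box d i p \<in> fixed_points n}"
      then have p: "p \<in> {1..i}" and np: "\<not> (p = i \<or> d i p < d (i - 1) p)"
        using add_box_in_fixed_points_iff[OF d i, of p] by blast+
      then have "d i p \<le> d (i - 1) p" by (intro fixed_points_antimono[OF d]) auto
      then have "d i p = d (i - 1) p" "p \<in> {1..i-1}" using p np by auto
      then have "(\<Prod>j=1..i-1. 1 - ss n N d i p / ss n N d (i - 1) j) = 0"
        by (intro prod_zero bexI[of _ p]) (simp_all add: ss_def)
      then show "fp_coeff n N d * inverse (1 - vv N ^ 2) * (?u p * ?Q p) = 0" by simp
    qed
  qed auto
  finally show ?thesis by (simp only: sum_distrib_left)
qed

text \<open>Distinct interpolation nodes: equal ones would make a torus weight with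
  \<open>j \<noteq> l\<close> trivial.\<close>

lemma inj_on_ss:
  assumes "N > 0" "i \<le> n"
  shows "inj_on (ss n N d i) {1..i}"
proof (rule inj_onI, rule ccontr)
  fix j l assume jl: "j \<in> {1..i}" "l \<in> {1..i}" "ss n N d i j = ss n N d i l" "j \<noteq> l"
  then have "torus_weight n N j l (int (d i l) - int (d i j)) = 1"
    by (simp flip: ss_quotient)
  then show False using torus_weight_neq_1[of N j n l] assms jl by auto
qed

section \<open>Bookkeeping of the powers of \<open>t\<close> and \<open>v\<close>\<close>

lemma prod_power_int:
  fixes x :: "'a::field"
  assumes "x \<noteq> 0"
  shows "(\<Prod>j\<in>A. x powi f j) = x powi (\<Sum>j\<in>A. f j)"
  by (induction A rule: infinite_finite_induct) (auto simp: power_int_add assms)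

text \<open>Up to a power of \<open>v\<close> depending only on \<open>i\<close>, this is the
  squared eigenvalue of \<open>L_i\<close>. Hence \<open>L_{i-1}^2 L_i^{-2}\<close> can compensate
  the quotient of node products in \<open>lagrange_eval_infinity\<close>.\<close>

lemma prod_ss: "(\<Prod>j=1..i. ss n N d i j) = (\<Prod>j=1..i. tt n j) ^ 2 * vv N powi (- 2 * int (deg d i))"
  by (simp only: ss_def prod.distrib prod_power_distrib prod_power_int vv_neq_0 deg_def of_nat_sum
      sum_distrib_left simp_thms not_False_eq_True)

lemma power_int_combine_e0:
  fixes x :: "'a::field"
  assumes "x \<noteq> 0"
  shows "x powi e / x powi a * x powi b = x powi (e - a + b)"
  using assms by (simp add: power_int_add power_int_diff)

lemma power_int_combine_e1:
  fixes x :: "'a::field"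
  assumes "x \<noteq> 0"
  shows "x powi e * x ^ i * (x powi z) ^ 2 / (x powi a) ^ 3 * x powi b * x powi r / x powi s =
    x powi (e + int i + z * 2 - a * 3 + b + r - s)"
proof -
  have "(x powi z) ^ 2 = x powi (z * 2)" "(x powi a) ^ 3 = x powi (a * 3)" "x ^ i = x powi int i"
    by (simp_all add: power_int_mult)
  then show ?thesis using assms by (simp only: power_int_add power_int_diff simp_thms)
qed

lemma triangular_succ: "int ((i + 1) * i div 2) = int (i * (i - 1) div 2) + int i"
proof -
  have "(i + 1) * i = i * (i - 1) + i * 2" by (cases i) (auto simp: algebra_simps)
  then show ?thesis by simp
qed

text \<open>The scalar in front of each interpolation term is \<open>v\<close>, independently of
  \<open>p\<close>, and the terms sum to 1 by \<open>lagrange_eval_0\<close>.\<close>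

lemma whittaker_e0:
  assumes d: "d \<in> fixed_points n" and "N > 0" and i: "i \<in> {1..n-1}"
  shows "e_op n N i 0 (L_pow n N i (-1) (L_pow n N (i + 1) 1 (whittaker n N))) d =
    vv N / (1 - vv N ^ 2) * fp_coeff n N d"
proof -
  let ?c = "\<lambda>d. L_eigenvalue n N i d powi (-1) * L_eigenvalue n N (i + 1) d"
  let ?u = "inverse (tt n (i + 1)) * vv N powi (int (deg d (i + 1)) - int (deg d i) - int i)"
  let ?Q = "\<lambda>p. (\<Prod>j\<in>{1..i} - {p}. inverse (1 - ss n N d i p / ss n N d i j)) *
    (\<Prod>j=1..i-1. 1 - ss n N d i p / ss n N d (i - 1) j)"
  have "?u * (vv N ^ i * ss n N d i p) powi 0 * ?c (add_box d i p) = vv N" if p: "p \<in> {1..i}" for p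
  proof -
    let ?T = "int (i * (i - 1) div 2)"
    let ?e = "int (deg d (i + 1)) - int (deg d i) - int i"
    let ?a = "?T - int (deg d i + 1)" and ?b = "?T + int i - int (deg d (i + 1))"
    define A where "A = (\<Prod>k=1..i. tt n k)"
    have "A \<noteq> 0" by (simp add: A_def)
    have E: "L_eigenvalue n N i (add_box d i p) = A * vv N powi ?a"
      "L_eigenvalue n N (i + 1) (add_box d i p) = A * tt n (i + 1) * vv N powi ?b"
      using deg_add_box[OF p, of d] triangular_succ[of i] by (simp_all add: L_eigenvalue_def A_def)
    \<comment> \<open>The 1 arises because \<open>L_i\<close> acts at \<open>d + \<delta>\<close>,
      where the degree in row \<open>i\<close> is larger by one.\<close>
    have "?e - ?a + ?b = 1" by simp
    then have v: "vv N powi ?e / vv N powi ?a * vv N powi ?b = vv N"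
      unfolding power_int_combine_e0[OF vv_neq_0] by (simp only: power_int_1_right)
    have "inverse t * x * 1 * (inverse (A * y) * (A * t * z)) = x / y * z" if "t \<noteq> 0" for t x y z :: scalar
      using that \<open>A \<noteq> 0\<close> by (simp add: field_simps)
    from this[OF tt_neq_0] show ?thesis
      unfolding E power_int_minus power_int_1_right power_int_0_right
      by (rule trans) (rule v)
  qed
  then have "(\<Sum>p=1..i. ?u * (vv N ^ i * ss n N d i p) powi 0 * ?c (add_box d i p) * ?Q p) =
      vv N * (\<Sum>p=1..i. ?Q p)"
    unfolding sum_distrib_left by (intro sum.cong) auto
  also have "(\<Sum>p=1..i. ?Q p) = 1"
    using i inj_on_ss[OF \<open>N > 0\<close>] by (intro lagrange_eval_0) auto
  finally have *: "(\<Sum>p=1..i. ?u * (vv N ^ i * ss n N d i p) powi 0 * ?c (add_box d i p) * ?Q p) = vv N"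
    by simp
  have "L_pow n N i (-1) (L_pow n N (i + 1) 1 (whittaker n N)) = (\<lambda>d. ?c d * whittaker n N d)"
    by (simp add: L_pow_def mult.assoc)
  then show ?thesis
    by (simp only: e_op_diagonal_whittaker[OF assms] *) (simp only: divide_inverse mult_ac)
qed

text \<open>Compared with \<open>e_{i,0}\<close> each term carries an additional node
  \<open>s_ip\<close>, so the sum is the quotient \<open>?x / ?y\<close> of node products; the
  additional \<open>L_{i-1}^2 L_i^{-2}\<close> supplies its inverse up to a power of
  \<open>v\<close>.\<close>

lemma whittaker_e1:
  assumes d: "d \<in> fixed_points n" and "N > 0" and i: "i \<in> {1..n-1}"
  shows "e_op n N i 1 (L_pow n N (i - 1) 2 (L_pow n N i (-3) (L_pow n N (i + 1) 1 (whittaker n N)))) d =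
    vv N powi (5 - int i) / (1 - vv N ^ 2) * fp_coeff n N d"
proof -
  let ?c = "\<lambda>d. L_eigenvalue n N (i - 1) d powi 2 * L_eigenvalue n N i d powi (-3) *
    L_eigenvalue n N (i + 1) d"
  let ?u = "inverse (tt n (i + 1)) * vv N powi (int (deg d (i + 1)) - int (deg d i) - int i)"
  let ?Q = "\<lambda>p. (\<Prod>j\<in>{1..i} - {p}. inverse (1 - ss n N d i p / ss n N d i j)) *
    (\<Prod>j=1..i-1. 1 - ss n N d i p / ss n N d (i - 1) j)"
  let ?x = "\<Prod>p=1..i. ss n N d i p" and ?y = "\<Prod>p=1..i-1. ss n N d (i - 1) p"
  have xy: "?x \<noteq> 0" "?y \<noteq> 0" by simp_all
  have const: "?u * (vv N ^ i * ss n N d i p) powi 1 * ?c (add_box d i p) =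
      vv N powi (5 - int i) * ?y / ?x * ss n N d i p" if p: "p \<in> {1..i}" for p
  proof -
    let ?T = "int (i * (i - 1) div 2)"
    let ?e = "int (deg d (i + 1)) - int (deg d i) - int i"
    let ?a = "?T - int (deg d i + 1)" and ?b = "?T + int i - int (deg d (i + 1))"
    let ?z = "?T - int (i - 1) - int (deg d (i - 1))"
    let ?r = "- 2 * int (deg d i)" and ?s = "- 2 * int (deg d (i - 1))"
    define A where "A = (\<Prod>k=1..i. tt n k)"
    define B where "B = (\<Prod>k=1..i-1. tt n k)"
    have "A \<noteq> 0" "B \<noteq> 0" by (simp_all add: A_def B_def)
    have i1: "i - 1 + 1 = i" "i - 1 \<noteq> i" using i by auto
    have T: "int ((i - 1) * (i - 1 - 1) div 2) = ?T - int (i - 1)"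
      using triangular_succ[of "i - 1"] unfolding i1(1) by linarith
    have E: "L_eigenvalue n N i (add_box d i p) = A * vv N powi ?a"
      "L_eigenvalue n N (i + 1) (add_box d i p) = A * tt n (i + 1) * vv N powi ?b"
      "L_eigenvalue n N (i - 1) (add_box d i p) = B * vv N powi ?z"
      using deg_add_box[OF p, of d] triangular_succ[of i] T i1(2)
      by (simp_all add: L_eigenvalue_def A_def B_def)
    \<comment> \<open>In the constant 5, the part 3 stems from \<open>L_i^{-3}\<close> at the raised
      degree and 2 from the triangular number in \<open>L_{i-1}^2\<close>.\<close>
    have "?e + int i + ?z * 2 - ?a * 3 + ?b + ?r - ?s = 5 - int i"
      using i by (simp add: of_nat_diff)
    then have v: "vv N powi (5 - int i) = vv N powi ?e * vv N ^ i * (vv N powi ?z) ^ 2 /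
        (vv N powi ?a) ^ 3 * vv N powi ?b * vv N powi ?r / vv N powi ?s"
      unfolding power_int_combine_e1[OF vv_neq_0] by (simp only:)
    \<comment> \<open>\<open>x5\<close> and \<open>x6\<close> stand for the \<open>v\<close>-parts
      of \<open>?x\<close> and \<open>?y\<close>; the \<open>t\<close>-parts \<open>A ^ 2\<close>
      and \<open>B ^ 2\<close> match those left by the eigenvalues.\<close>
    have key: "inverse t * x1 * (w * s) * ((B * x2) ^ 2 * inverse ((A * x3) ^ 3) * (A * t * x4)) =
        x1 * w * x2 ^ 2 / x3 ^ 3 * x4 * x5 / x6 * (B ^ 2 * x6) / (A ^ 2 * x5) * s"
      if "t \<noteq> 0" "x3 \<noteq> 0" "x5 \<noteq> 0" "x6 \<noteq> 0" for t x1 x2 x3 x4 x5 x6 s w :: scalar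
      using that \<open>A \<noteq> 0\<close> \<open>B \<noteq> 0\<close> by (simp add: field_simps power2_eq_square power3_eq_cube)
    have p2: "x powi 2 = x ^ 2" "x powi (-3) = inverse (x ^ 3)" for x :: scalar
      by (simp_all add: power_int_minus)
    show ?thesis
      unfolding E p2 power_int_1_right v prod_ss A_def[symmetric] B_def[symmetric]
      by (rule key) (simp_all add: power_int_eq_0_iff)
  qed
  have "(\<Sum>p=1..i. ?u * (vv N ^ i * ss n N d i p) powi 1 * ?c (add_box d i p) * ?Q p) =
      (\<Sum>p=1..i. vv N powi (5 - int i) * ?y / ?x * (ss n N d i p * ?Q p))"
  proof (rule sum.cong[OF refl])
    fix p assume "p \<in> {1..i}"
    from const[OF this] show "?u * (vv N ^ i * ss n N d i p) powi 1 * ?c (add_box d i p) * ?Q p =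
        vv N powi (5 - int i) * ?y / ?x * (ss n N d i p * ?Q p)"
      by (simp only: mult.assoc)
  qed
  also have "\<dots> = vv N powi (5 - int i) * ?y / ?x * (\<Sum>p=1..i. ss n N d i p * ?Q p)"
    by (simp only: sum_distrib_left)
  also have "(\<Sum>p=1..i. ss n N d i p * ?Q p) = ?x / ?y"
    using i inj_on_ss[OF \<open>N > 0\<close>] by (intro lagrange_eval_infinity) auto
  also have "vv N powi (5 - int i) * ?y / ?x * (?x / ?y) = vv N powi (5 - int i)"
    using xy by simp
  finally have *: "(\<Sum>p=1..i. ?u * (vv N ^ i * ss n N d i p) powi 1 * ?c (add_box d i p) * ?Q p) =
    vv N powi (5 - int i)" .
  have "L_pow n N (i - 1) 2 (L_pow n N i (-3) (L_pow n N (i + 1) 1 (whittaker n N))) =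
      (\<lambda>d. ?c d * whittaker n N d)"
    by (simp add: L_pow_def mult.assoc)
  then show ?thesis
    by (simp only: e_op_diagonal_whittaker[OF assms] *) (simp only: divide_inverse mult_ac)
qed

theorem proposition5p14:
  fixes n N :: nat
  assumes "n \<ge> 1" and "admissible_root n N"
  shows "whittaker n N \<in> M_hat n \<and>
    (\<forall>i\<in>{1..n-1}.
       e_op n N i 0 (L_pow n N i (-1) (L_pow n N (i + 1) 1 (whittaker n N))) =
       scale (vv N / (1 - vv N ^ 2)) (whittaker n N)) \<and>
    (\<forall>i\<in>{1..n-1}.
       e_op n N i 1 (L_pow n N (i - 1) 2 (L_pow n N i (-3) (L_pow n N (i + 1) 1 (whittaker n N)))) =
       scale (vv N powi (5 - int i) / (1 - vv N ^ 2)) (whittaker n N))"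
proof (intro conjI ballI ext)
  have "N > 0" using assms(2) by (simp add: admissible_root_def)
  show "whittaker n N \<in> M_hat n" by (rule whittaker_in_M_hat[OF assms(1)])
  fix i d assume i: "i \<in> {1..n-1}"
  \<comment> \<open>Away from the fixed points both sides are 0 by the conventions of the
    model.\<close>
  have outside: "e_op n N i r x d = scale c (whittaker n N) d" if "d \<notin> fixed_points n" for r x c
    using that by (simp add: e_op_def scale_def whittaker_apply)
  show "e_op n N i 0 (L_pow n N i (-1) (L_pow n N (i + 1) 1 (whittaker n N))) d =
      scale (vv N / (1 - vv N ^ 2)) (whittaker n N) d"
    using whittaker_e0[OF _ \<open>N > 0\<close> i] outside
    by (cases "d \<in> fixed_points n") (simp_all add: scale_def whittaker_apply del: One_nat_def)
  show "e_op n N i 1 (L_pow n N (i - 1) 2 (L_pow n N i (-3) (L_pow n N (i + 1) 1 (whittaker n N)))) d =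
      scale (vv N powi (5 - int i) / (1 - vv N ^ 2)) (whittaker n N) d"
    using whittaker_e1[OF _ \<open>N > 0\<close> i] outside
    by (cases "d \<in> fixed_points n") (simp_all add: scale_def whittaker_apply del: One_nat_def)
qed

end
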